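(* Let $k\ge2$. An element of the $k$-shape poset is maximal (resp. minimal) if and only if it is a $(k+1)$-core (resp. a $k$-core).
   Context: Fix an integer $k\ge 2$. A partition $\lambda=(\lambda_1\ge\lambda_2\ge\cdots)$ is identified with its Ferrers diagram $\{(i,j)\in\mathbb Z_{>0}^2: j\le\lambda_i\}$ in French convention: the cell $(i,j)$ is in row $i$ and column $j$, row indices increase from bottom to top (so "above" means larger row index) and column indices increase from left to right; $\lambda^t$ is the transpose. For $b=(i,j)\in\lambda$ the hook length is $h_\lambda(b)=(\lambda_i-j)+(\lambda^t_j-i)+1$. The $k$-boundary of $\lambda$ is $\partial\lambda=\{b\in\lambda: h_\lambda(b)\le k\}$; $\mathrm{rs}(\lambda)$ (resp. $\mathrm{cs}(\lambda)$) is the sequence whose $i$-th entry is the number of cells of $\partial\lambda$ in row $i$ (resp. column $i$). $\lambda$ is a $k$-shape if both $\mathrm{rs}(\lambda)$ and $\mathrm{cs}(\lambda)$ are partitions (weakly decreasing); $\Pi^k$ is the set of $k$-shapes and $\Pi^k_N$ the set of those with $|\partial\lambda|=N$. An $n$-core is a partition with no cell of hook length $n$. Moves. The diagonal index of $b=(i,j)$ is $d(b)=j-i$; two cells $b,b'$ are contiguous if $|d(b)-d(b')|\in\{k,k+1\}$. A string of length $\ell$ is a skew shape $\mu/\lambda$ ($\lambda\subset\mu$ partitions) with cells $a_1,\dots,a_\ell$ such that $a_{i+1}$ is below $a_i$ and contiguous to it for $1\le i<\ell$. Let $b_0$ be the leftmost cell of $\partial\lambda$ in the row of $a_1$, $b_\ell$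 the bottom cell of $\partial\lambda$ in the column of $a_\ell$, and $b_i=(\mathrm{row}(a_{i+1}),\mathrm{col}(a_i))$ for $1\le i<\ell$. The string is row-type if $\partial\lambda\setminus\partial\mu=\{b_0,\dots,b_{\ell-1}\}$ and column-type if $\partial\lambda\setminus\partial\mu=\{b_1,\dots,b_\ell\}$. For a skew shape $\mu/\lambda$ let $\Delta_{\mathrm{rs}}=\mathrm{rs}(\mu)-\mathrm{rs}(\lambda)$, $\Delta_{\mathrm{cs}}=\mathrm{cs}(\mu)-\mathrm{cs}(\lambda)$; the positively (negatively) modified rows/columns are those with positive (negative) entry; a string has at most one of each kind. Two strings $\mu/\lambda$, $\mu'/\lambda'$ are translates if their cell sets differ by translation by a fixed vector of $\mathbb Z^2$ and their corresponding modified rows and columns agree in size (if $c,c'$ are their negatively modified columns then $\mathrm{cs}(\lambda)_c=\mathrm{cs}(\lambda')_{c'}$, and similarly for positively modified columns and for modified rows). A row move $m$ of rank $r$ and length $\ell$ from $\lambda$ to $\mu$ is a chain of partitions $\lambda=\lambda^0\subset\lambda^1\subset\dots\subset\lambda^r=\mu$ with $\lambda,\mu\in\Pi^k$ such that each $s_i=\lambda^i/\lambda^{i-1}$ is a row-type string of $\ell$ cells, the $s_i$ are translates of each other, and the top cells of $s_1,\dots,s_r$ occur in consecutive columns from left to right. A column move is the transpose analogue (the transposed chain is a row move from $\lambda^t$ to $\mu^t$). A move is a row move or a column move; moves preserve $|\partial\lambda|$. The $k$-shape poset: on each $\Pi^k_N$ put a directed edge from $\lambda$ to $\mu$ whenever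 there is a (nonempty) move from $\lambda$ to $\mu$; this directed graph is acyclic, and the partial order is generated by declaring $\lambda>\mu$ for each such edge. Thus a maximal element is a $k$-shape to which there is no move, and a minimal element is one from which there is no move. *)

theory Defs
  imports Main
begin

text \<open>
  A partition is a sequence indexed by the positive integers (the value at index 0 is
  irrelevant). It is identified with its Ferrers diagram, a set of cells (row, column) with both
  coordinates starting at 1, in French convention: ``above'' means a larger row index. As a
  diagram is a binary relation, the transposed partition is the converse relation.
\<close>

definition is_partition :: "(nat \<Rightarrow> nat) \<Rightarrow> bool" where
  "is_partition p \<longleftrightarrow> (\<forall>i\<ge>1. p (Suc i) \<le> p i) \<and> finite {i. i \<ge> 1 \<and> p i \<noteq> 0}"

type_synonym cell = "nat \<times> nat"
type_synonym diagram = "cell set"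

abbreviation row :: "cell \<Rightarrow> nat" where "row \<equiv> fst"
abbreviation col :: "cell \<Rightarrow> nat" where "col \<equiv> snd"

definition ferrers :: "(nat \<Rightarrow> nat) \<Rightarrow> diagram" where
  "ferrers p = {(i, j). 1 \<le> i \<and> 1 \<le> j \<and> j \<le> p i}"

definition is_diagram :: "diagram \<Rightarrow> bool" where
  "is_diagram D \<longleftrightarrow> (\<exists>p. is_partition p \<and> D = ferrers p)"

definition row_count :: "diagram \<Rightarrow> nat \<Rightarrow> nat" where
  "row_count D i = card {j. (i, j) \<in> D}"

definition col_count :: "diagram \<Rightarrow> nat \<Rightarrow> nat" where
  "col_count D j = card {i. (i, j) \<in> D}"

text \<open>Natural-number subtraction is harmless here: hook lengths are only used for cells of
  the diagram.\<close>

definition hook_length :: "diagram \<Rightarrow> cell \<Rightarrow> nat" where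
  "hook_length D b = (row_count D (row b) - col b) + (col_count D (col b) - row b) + 1"

definition boundary :: "nat \<Rightarrow> diagram \<Rightarrow> diagram" where
  "boundary k D = {b \<in> D. hook_length D b \<le> k}"

definition rs :: "nat \<Rightarrow> diagram \<Rightarrow> nat \<Rightarrow> nat" where
  "rs k D = row_count (boundary k D)"

definition cs :: "nat \<Rightarrow> diagram \<Rightarrow> nat \<Rightarrow> nat" where
  "cs k D = col_count (boundary k D)"

definition is_core :: "nat \<Rightarrow> diagram \<Rightarrow> bool" where
  "is_core n D \<longleftrightarrow> is_diagram D \<and> (\<forall>b\<in>D. hook_length D b \<noteq> n)"

definition kshapes :: "nat \<Rightarrow> diagram set" where
  "kshapes k = {D. is_diagram D \<and> is_partition (rs k D) \<and> is_partition (cs k D)}"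

definition kshapes_of_size :: "nat \<Rightarrow> nat \<Rightarrow> diagram set" where
  "kshapes_of_size k N = {D \<in> kshapes k. card (boundary k D) = N}"

definition diag :: "cell \<Rightarrow> int" where
  "diag b = int (col b) - int (row b)"

definition contiguous :: "nat \<Rightarrow> cell \<Rightarrow> cell \<Rightarrow> bool" where
  "contiguous k b b' \<longleftrightarrow> \<bar>diag b - diag b'\<bar> \<in> {int k, int k + 1}"

text \<open>The cells \<open>a\<^sub>1, \<dots>, a\<^sub>l\<close> of a string are given as a list, so \<open>a\<^sub>i\<close> is \<open>as ! (i - 1)\<close>.\<close>

definition is_string :: "nat \<Rightarrow> diagram \<Rightarrow> diagram \<Rightarrow> cell list \<Rightarrow> bool" where
  "is_string k D E as \<longleftrightarrow>
     is_diagram D \<and> is_diagram E \<and> D \<subseteq> E \<and> E - D = set as \<and> as \<noteq> [] \<and>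
     (\<forall>i. Suc i < length as \<longrightarrow>
        row (as ! Suc i) < row (as ! i) \<and> contiguous k (as ! i) (as ! Suc i))"

definition leftmost_in_row :: "diagram \<Rightarrow> nat \<Rightarrow> cell \<Rightarrow> bool" where
  "leftmost_in_row S i b \<longleftrightarrow> b \<in> S \<and> row b = i \<and> (\<forall>b'\<in>S. row b' = i \<longrightarrow> col b \<le> col b')"

text \<open>Row-type means that the boundary cells lost are exactly \<open>b\<^sub>0, \<dots>, b\<^bsub>l-1\<^esub>\<close>; in particular
  \<open>b\<^sub>0\<close> must exist, that is, the row of \<open>a\<^sub>1\<close> must meet the boundary.\<close>

definition row_type_string :: "nat \<Rightarrow> diagram \<Rightarrow> diagram \<Rightarrow> cell list \<Rightarrow> bool" where
  "row_type_string k D E as \<longleftrightarrow>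
     is_string k D E as \<and>
     (\<exists>b0. leftmost_in_row (boundary k D) (row (hd as)) b0 \<and>
        boundary k D - boundary k E =
          insert b0 {(row (as ! Suc i), col (as ! i)) | i. Suc i < length as})"

text \<open>The size conditions on modified rows and columns are quantified over all rows and columns
  of each kind; a row-type string has at most one of each.\<close>

definition translates ::
    "nat \<Rightarrow> diagram \<Rightarrow> diagram \<Rightarrow> diagram \<Rightarrow> diagram \<Rightarrow> bool" where
  "translates k D E D' E' \<longleftrightarrow>
     (\<exists>u v :: int. (\<lambda>(i, j). (int i, int j)) ` (E' - D') =
                   (\<lambda>(i, j). (int i + u, int j + v)) ` (E - D)) \<and>
     (\<forall>c c'. cs k E c < cs k D c \<and> cs k E' c' < cs k D' c' \<longrightarrow> cs k D c = cs k D' c') \<and>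
     (\<forall>c c'. cs k E c > cs k D c \<and> cs k E' c' > cs k D' c' \<longrightarrow> cs k D c = cs k D' c') \<and>
     (\<forall>r r'. rs k E r < rs k D r \<and> rs k E' r' < rs k D' r' \<longrightarrow> rs k D r = rs k D' r') \<and>
     (\<forall>r r'. rs k E r > rs k D r \<and> rs k E' r' > rs k D' r' \<longrightarrow> rs k D r = rs k D' r')"

definition row_move :: "nat \<Rightarrow> nat \<Rightarrow> nat \<Rightarrow> diagram \<Rightarrow> diagram \<Rightarrow> bool" where
  "row_move k r l D E \<longleftrightarrow>
     D \<in> kshapes k \<and> E \<in> kshapes k \<and>
     (\<exists>(C :: nat \<Rightarrow> diagram) (s :: nat \<Rightarrow> cell list).
        C 0 = D \<and> C r = E \<and>
        (\<forall>i<r. row_type_string k (C i) (C (Suc i)) (s i) \<and> length (s i) = l) \<and>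
        (\<forall>i<r. \<forall>j<r. translates k (C i) (C (Suc i)) (C j) (C (Suc j))) \<and>
        (\<forall>i. Suc i < r \<longrightarrow> col (hd (s (Suc i))) = Suc (col (hd (s i)))))"

definition column_move :: "nat \<Rightarrow> nat \<Rightarrow> nat \<Rightarrow> diagram \<Rightarrow> diagram \<Rightarrow> bool" where
  "column_move k r l D E \<longleftrightarrow> row_move k r l (D\<inverse>) (E\<inverse>)"

text \<open>A move of rank 0 is the empty move.\<close>

definition nonempty_move :: "nat \<Rightarrow> diagram \<Rightarrow> diagram \<Rightarrow> bool" where
  "nonempty_move k D E \<longleftrightarrow> (\<exists>r\<ge>1. \<exists>l. row_move k r l D E \<or> column_move k r l D E)"

definition kshape_edge :: "nat \<Rightarrow> nat \<Rightarrow> diagram \<Rightarrow> diagram \<Rightarrow> bool" where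
  "kshape_edge k N D E \<longleftrightarrow>
     D \<in> kshapes_of_size k N \<and> E \<in> kshapes_of_size k N \<and> nonempty_move k D E"

text \<open>The source of an edge is the greater element.\<close>

definition kshape_less :: "nat \<Rightarrow> nat \<Rightarrow> diagram \<Rightarrow> diagram \<Rightarrow> bool" where
  "kshape_less k N = (\<lambda>E D. kshape_edge k N D E)\<^sup>+\<^sup>+"

definition kshape_maximal :: "nat \<Rightarrow> nat \<Rightarrow> diagram \<Rightarrow> bool" where
  "kshape_maximal k N D \<longleftrightarrow>
     D \<in> kshapes_of_size k N \<and> \<not> (\<exists>E\<in>kshapes_of_size k N. kshape_less k N D E)"

definition kshape_minimal :: "nat \<Rightarrow> nat \<Rightarrow> diagram \<Rightarrow> bool" where
  "kshape_minimal k N D \<longleftrightarrow>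
     D \<in> kshapes_of_size k N \<and> \<not> (\<exists>E\<in>kshapes_of_size k N. kshape_less k N E D)"

end

theory Submission
  imports Defs
begin

text \<open>
  A row-type string adds exactly one cell to the row of \<open>b\<^sub>0\<close> and none to its column,
  so the hook of \<open>b\<^sub>0\<close> grows from \<open>k\<close> to \<open>k + 1\<close>
  (\<open>row_type_string_hooks\<close>). Hence the source of a nonempty move has a hook of length
  \<open>k\<close> and its target one of length \<open>k + 1\<close>: a \<open>k\<close>-core is minimal
  and a \<open>(k + 1)\<close>-core is maximal.

  For the converses a move is built from one cell with the critical hook length. The boundary cells of a
  row are its last \<open>rs\<close> cells, and those of a column its last \<open>cs\<close> cells; so
  \<open>hook_le_iff_rs\<close> and \<open>hook_le_iff_cs\<close> turn every question about hooks into
  linear arithmetic with row lengths, column heights and the two size sequences. Only row moves of a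
  simple kind are needed: a decreasing list of rows, each of which receives \<open>M\<close> new cells at
  its end, the \<open>n\<close>-th string being formed by the \<open>n\<close>-th new cells (locale
  \<open>strips\<close>). Such a move keeps all row sizes, takes one cell from the boundary of each of
  \<open>M\<close> consecutive columns and gives one to each of \<open>M\<close> columns further to the
  right (\<open>rs_filled\<close>, \<open>cs_filled\<close>). The column sizes remain weakly decreasing
  if the losing columns end a block of columns of equal size and the gaining columns begin one.

  From a hook of length \<open>k\<close> in row \<open>r\<close> and column \<open>c\<close>, let the
  columns from \<open>c\<close> to the end of its block lose. Cells are added in row \<open>r\<close>. If
  the columns on which they land do not begin a block, or lose a boundary cell themselves, then the
  bottom boundary cell of the first of them has hook length \<open>k - 1\<close> or \<open>k\<close>, and
  cells added in the row of that cell cancel the gain and pass it on to columns further right. The rows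
  descend, so this stops, and it stops at a legal move (locale \<open>move_source\<close>). The rightmost
  admissible \<open>c\<close> is chosen because then all columns of the block have the same height, which
  makes the strings translates of one another. The construction needs column \<open>c\<close> to have
  size at least two; otherwise row \<open>r\<close> has size \<open>k\<close> and the transposed diagram
  is used. Starting from a hook of length \<open>k + 1\<close>, the leftmost one, the same argument read
  backwards removes cells and finds a source (locale \<open>move_target\<close>).
\<close>

section \<open>Diagrams, hooks and the boundary\<close>

lemma is_diagramI:
  assumes "finite D" and "\<And>x y. (x, y) \<in> D \<Longrightarrow> 1 \<le> x \<and> 1 \<le> y"
    and down: "\<And>x y x' y'. (x, y) \<in> D \<Longrightarrow> 1 \<le> x' \<Longrightarrow> x' \<le> x \<Longrightarrow> 1 \<le> y' \<Longrightarrow> y' \<le> y \<Longrightarrow> (x', y') \<in> D"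
  shows "is_diagram D"
proof -
  have fin: "finite {j. (x, j) \<in> D}" for x
    by (rule finite_subset[OF _ finite_imageI[OF assms(1), of snd]]) force
  have row: "{j. (x, j) \<in> D} = {1..row_count D x}" for x
  proof (cases "{j. (x, j) \<in> D} = {}")
    case True
    then show ?thesis by (simp add: row_count_def)
  next
    case False
    define m where "m = Max {j. (x, j) \<in> D}"
    have m: "(x, m) \<in> D" using Max_in[OF fin False] by (simp add: m_def)
    have "{j. (x, j) \<in> D} = {1..m}"
    proof (intro set_eqI iffI)
      fix j assume "j \<in> {j. (x, j) \<in> D}"
      then show "j \<in> {1..m}" using Max_ge[OF fin, of j x] assms(2)[of x j] by (simp add: m_def)
    next
      fix j assume "j \<in> {1..m}"
      then show "j \<in> {j. (x, j) \<in> D}" using down[OF m, of x j] assms(2)[OF m] by simp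
    qed
    then show ?thesis by (simp add: row_count_def)
  qed
  have mem: "(x, y) \<in> D \<longleftrightarrow> 1 \<le> y \<and> y \<le> row_count D x" for x y
    using row[of x] by (auto simp: set_eq_iff)
  have "is_partition (row_count D)"
    unfolding is_partition_def
  proof (intro conjI allI impI)
    fix i :: nat assume "1 \<le> i"
    have "(i, j) \<in> D" if "(Suc i, j) \<in> D" for j
      using down[OF that \<open>1 \<le> i\<close>] assms(2)[OF that] by simp
    then have "{j. (Suc i, j) \<in> D} \<subseteq> {j. (i, j) \<in> D}" by blast
    then show "row_count D (Suc i) \<le> row_count D i"
      unfolding row_count_def by (rule card_mono[OF fin])
  next
    have "{i. 1 \<le> i \<and> row_count D i \<noteq> 0} \<subseteq> fst ` D"
    proof
      fix i assume "i \<in> {i. 1 \<le> i \<and> row_count D i \<noteq> 0}"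
      then have "(i, 1) \<in> D" using mem[of i 1] by simp
      then show "i \<in> fst ` D" by force
    qed
    then show "finite {i. 1 \<le> i \<and> row_count D i \<noteq> 0}" using assms(1) by (meson finite_imageI finite_subset)
  qed
  moreover have "D = ferrers (row_count D)"
  proof (intro set_eqI)
    fix b show "b \<in> D \<longleftrightarrow> b \<in> ferrers (row_count D)"
      using mem[of "fst b" "snd b"] assms(2)[of "fst b" "snd b"]
      unfolding ferrers_def by (cases b) auto
  qed
  ultimately show ?thesis unfolding is_diagram_def by blast
qed

lemma is_partition_mono:
  assumes "is_partition p" "1 \<le> i" "i \<le> j"
  shows "p j \<le> p i"
  using assms(3)
proof (induction rule: dec_induct)
  case (step n)
  then show ?case using assms(1,2) unfolding is_partition_def by (meson le_trans)
qed simp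

lemma mem_diagram_row:
  assumes "is_diagram D"
  shows "(x, y) \<in> D \<longleftrightarrow> 1 \<le> x \<and> 1 \<le> y \<and> y \<le> row_count D x"
proof -
  obtain p where p: "D = ferrers p" using assms unfolding is_diagram_def by blast
  have "{j. (x, j) \<in> D} = (if 1 \<le> x then {1..p x} else {})"
    unfolding p ferrers_def by auto
  then have "row_count D x = (if 1 \<le> x then p x else 0)" unfolding row_count_def by simp
  then show ?thesis unfolding p ferrers_def by auto
qed

lemma finite_diagram:
  assumes "is_diagram D"
  shows "finite D"
proof -
  obtain p where p: "is_partition p" "D = ferrers p" using assms unfolding is_diagram_def by blast
  have "D \<subseteq> Sigma {i. i \<ge> 1 \<and> p i \<noteq> 0} (\<lambda>i. {1..p i})"
    unfolding p ferrers_def by auto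
  then show ?thesis using p(1) unfolding is_partition_def by (meson finite_SigmaI finite_atLeastAtMost finite_subset)
qed

lemma diagram_down:
  assumes "is_diagram D" "(x, y) \<in> D" "1 \<le> x'" "x' \<le> x" "1 \<le> y'" "y' \<le> y"
  shows "(x', y') \<in> D"
proof -
  obtain p where p: "is_partition p" "D = ferrers p" using assms(1) unfolding is_diagram_def by blast
  have "p x \<le> p x'" using is_partition_mono[OF p(1) assms(3,4)] .
  then show ?thesis using assms(2-) unfolding p ferrers_def by auto
qed

lemma row_count_converse: "row_count (D\<inverse>) = col_count D"
  by (simp add: fun_eq_iff row_count_def col_count_def)

lemma col_count_converse: "col_count (D\<inverse>) = row_count D"
  by (simp add: fun_eq_iff row_count_def col_count_def)

lemma hook_length_converse: "hook_length (D\<inverse>) (y, x) = hook_length D (x, y)"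
  by (simp add: hook_length_def row_count_converse col_count_converse)

lemma is_diagram_converse [simp]: "is_diagram (D\<inverse>) \<longleftrightarrow> is_diagram D"
proof -
  have "is_diagram (D\<inverse>)" if "is_diagram D" for D
  proof (rule is_diagramI)
    show "finite (D\<inverse>)" using finite_diagram[OF that] by simp
    show "1 \<le> x \<and> 1 \<le> y" if "(x, y) \<in> D\<inverse>" for x y
      using that mem_diagram_row[OF \<open>is_diagram D\<close>] by auto
    show "(x', y') \<in> D\<inverse>" if "(x, y) \<in> D\<inverse>" "1 \<le> x'" "x' \<le> x" "1 \<le> y'" "y' \<le> y" for x y x' y'
      using diagram_down[OF \<open>is_diagram D\<close>, of y x y' x'] that by simp
  qed
  from this[of D] this[of "D\<inverse>"] show ?thesis by auto
qed

lemma mem_diagram_col: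
  assumes "is_diagram D"
  shows "(x, y) \<in> D \<longleftrightarrow> 1 \<le> x \<and> 1 \<le> y \<and> x \<le> col_count D y"
  using mem_diagram_row[of "D\<inverse>" y x] assms by (auto simp: row_count_converse)

lemma row_count_mono:
  assumes "is_diagram D" "1 \<le> x" "x \<le> x'"
  shows "row_count D x' \<le> row_count D x"
proof (cases "row_count D x' = 0")
  case False
  then have "(x', row_count D x') \<in> D" using assms mem_diagram_row by simp
  then have "(x, row_count D x') \<in> D" using diagram_down[OF assms(1)] assms False by simp
  then show ?thesis using mem_diagram_row[OF assms(1)] by simp
qed simp

lemma col_count_mono:
  assumes "is_diagram D" "1 \<le> y" "y \<le> y'"
  shows "col_count D y' \<le> col_count D y"
  using row_count_mono[of "D\<inverse>"] assms by (simp add: row_count_converse)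

lemma row_le_iff_col_le:
  assumes "is_diagram D" "1 \<le> x" "1 \<le> y"
  shows "y \<le> row_count D x \<longleftrightarrow> x \<le> col_count D y"
  using mem_diagram_row[OF assms(1), of x y] mem_diagram_col[OF assms(1), of x y] assms by auto

text \<open>The additive form keeps subtraction of natural numbers out of the arithmetic below.\<close>

lemma hook_length_add:
  assumes "is_diagram D" "(x, y) \<in> D"
  shows "hook_length D (x, y) + x + y = row_count D x + col_count D y + 1"
  using assms mem_diagram_row[OF assms(1), of x y] mem_diagram_col[OF assms(1), of x y]
  unfolding hook_length_def by simp

lemma hook_length_left:
  assumes "is_diagram D" "(x, y) \<in> D" "1 \<le> y'" "y' \<le> y"
  shows "hook_length D (x, y) + y \<le> hook_length D (x, y') + y'"
proof -
  have "(x, y') \<in> D" using assms mem_diagram_row[OF assms(1)] by simp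
  then show ?thesis
    using hook_length_add[OF assms(1), of x y] hook_length_add[OF assms(1), of x y']
      col_count_mono[OF assms(1,3,4)] assms(2) by simp
qed

lemma hook_length_below:
  assumes "is_diagram D" "(x, y) \<in> D" "1 \<le> x'" "x' \<le> x"
  shows "hook_length D (x, y) + x \<le> hook_length D (x', y) + x'"
  using hook_length_left[of "D\<inverse>" y x x'] assms by (simp add: hook_length_converse)

lemma boundary_converse: "boundary k (D\<inverse>) = (boundary k D)\<inverse>"
  unfolding boundary_def by (auto simp: hook_length_converse)

lemma rs_converse: "rs k (D\<inverse>) = cs k D"
  unfolding rs_def cs_def by (simp add: boundary_converse row_count_converse)

lemma cs_converse: "cs k (D\<inverse>) = rs k D"
  unfolding rs_def cs_def by (simp add: boundary_converse col_count_converse)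

lemma kshapes_converse [simp]: "D\<inverse> \<in> kshapes k \<longleftrightarrow> D \<in> kshapes k"
  unfolding kshapes_def by (auto simp: rs_converse cs_converse)

lemma kshapes_of_size_converse [simp]: "D\<inverse> \<in> kshapes_of_size k N \<longleftrightarrow> D \<in> kshapes_of_size k N"
  unfolding kshapes_of_size_def by (auto simp: boundary_converse)

text \<open>Hook lengths decrease strictly along a row, so the boundary cells of a row are its last
  \<open>rs\<close> cells. This is what lets the row sizes, being weakly decreasing, control hook
  lengths.\<close>

lemma hook_le_iff_rs:
  assumes D: "is_diagram D" and xy: "(x, y) \<in> D"
  shows "hook_length D (x, y) \<le> k \<longleftrightarrow> row_count D x < rs k D x + y"
proof -
  let ?S = "{j. (x, j) \<in> boundary k D}"
  have sub: "?S \<subseteq> {1..row_count D x}"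
    unfolding boundary_def using mem_diagram_row[OF D] by auto
  have x: "1 \<le> x" "1 \<le> y" "y \<le> row_count D x" using xy mem_diagram_row[OF D] by auto
  have dec: "hook_length D (x, b) + b \<le> hook_length D (x, a) + a" if "1 \<le> a" "a \<le> b" "b \<le> row_count D x" for a b
    using hook_length_left[OF D, of x b a] mem_diagram_row[OF D] that x(1) by simp
  show ?thesis
  proof
    assume h: "hook_length D (x, y) \<le> k"
    have "{y..row_count D x} \<subseteq> ?S"
      unfolding boundary_def using dec[of y] h x mem_diagram_row[OF D] by fastforce
    then have "card {y..row_count D x} \<le> rs k D x"
      unfolding rs_def row_count_def[of "boundary k D"] using sub finite_subset by (intro card_mono) blast+
    then show "row_count D x < rs k D x + y" using x by simp
  next
    assume h: "row_count D x < rs k D x + y"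
    show "hook_length D (x, y) \<le> k"
    proof (rule ccontr)
      assume n: "\<not> hook_length D (x, y) \<le> k"
      have "?S \<subseteq> {Suc y..row_count D x}"
      proof
        fix j assume j: "j \<in> ?S"
        then have "1 \<le> j" "j \<le> row_count D x" using sub by auto
        moreover have "hook_length D (x, j) \<le> k" using j unfolding boundary_def by simp
        then have "\<not> j \<le> y" using dec[of j y] \<open>1 \<le> j\<close> x n by auto
        ultimately show "j \<in> {Suc y..row_count D x}" by simp
      qed
      then have "rs k D x \<le> card {Suc y..row_count D x}"
        unfolding rs_def row_count_def[of "boundary k D"] by (intro card_mono) auto
      then show False using h x by simp
    qed
  qed
qed

lemma hook_le_iff_cs:
  assumes "is_diagram D" "(x, y) \<in> D"
  shows "hook_length D (x, y) \<le> k \<longleftrightarrow> col_count D y < cs k D y + x"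
  using hook_le_iff_rs[of "D\<inverse>" y x k] assms
  by (simp add: hook_length_converse rs_converse row_count_converse)

text \<open>The bookkeeping for one string: the boundary loses the cells \<open>L\<close> and gains the
  cells \<open>N\<close>.\<close>

lemma col_count_exchange:
  assumes "finite S" "finite N" "L \<subseteq> S" "S \<inter> N = {}"
  shows "col_count ((S - L) \<union> N) y + col_count L y = col_count S y + col_count N y"
proof -
  have fin: "finite {i. (i, y) \<in> T}" if "finite T" for T :: diagram
    by (rule finite_subset[OF _ finite_imageI[OF that, of fst]]) force
  have "{i. (i, y) \<in> (S - L) \<union> N} = ({i. (i, y) \<in> S} - {i. (i, y) \<in> L}) \<union> {i. (i, y) \<in> N}" by auto
  moreover have "card (({i. (i, y) \<in> S} - {i. (i, y) \<in> L}) \<union> {i. (i, y) \<in> N}) =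
      card ({i. (i, y) \<in> S} - {i. (i, y) \<in> L}) + card {i. (i, y) \<in> N}"
    using assms by (intro card_Un_disjoint fin finite_Diff) auto
  moreover have "card ({i. (i, y) \<in> S} - {i. (i, y) \<in> L}) + card {i. (i, y) \<in> L} = card {i. (i, y) \<in> S}"
  proof -
    have sub: "{i. (i, y) \<in> L} \<subseteq> {i. (i, y) \<in> S}" using assms by auto
    have "finite {i. (i, y) \<in> L}" using fin[OF finite_subset[OF assms(3,1)]] .
    then show ?thesis using card_Diff_subset[OF _ sub] card_mono[OF fin[OF assms(1)] sub] by simp
  qed
  ultimately show ?thesis unfolding col_count_def by simp
qed

lemma row_count_exchange:
  assumes "finite S" "finite N" "L \<subseteq> S" "S \<inter> N = {}"
  shows "row_count ((S - L) \<union> N) x + row_count L x = row_count S x + row_count N x"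
proof -
  have "((S - L) \<union> N)\<inverse> = (S\<inverse> - L\<inverse>) \<union> N\<inverse>" by auto
  then show ?thesis
    using col_count_exchange[of "S\<inverse>" "N\<inverse>" "L\<inverse>" x] assms
    by (auto simp: col_count_converse[symmetric])
qed

lemma cs_le_col_count:
  assumes "is_diagram D"
  shows "cs k D y \<le> col_count D y"
proof -
  have "{i. (i, y) \<in> boundary k D} \<subseteq> {i. (i, y) \<in> D}" unfolding boundary_def by auto
  moreover have "finite {i. (i, y) \<in> D}"
    by (rule finite_subset[OF _ finite_imageI[OF finite_diagram[OF assms], of fst]]) force
  ultimately show ?thesis unfolding cs_def col_count_def by (rule card_mono[rotated])
qed

text \<open>A cell with hook length \<open>k\<close> is the first boundary cell both of its row and of
  its column.\<close>

lemma hook_eq_cs: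
  assumes "is_diagram D" "(x, y) \<in> D" "hook_length D (x, y) = k"
  shows "col_count D y + 1 = cs k D y + x"
proof (cases "x = 1")
  case True
  then show ?thesis using hook_le_iff_cs[OF assms(1,2), of k] assms(3) cs_le_col_count[OF assms(1), of k y] by simp
next
  case False
  have x: "1 \<le> x" using assms(1,2) mem_diagram_row by blast
  have mem: "(x - 1, y) \<in> D" using mem_diagram_col[OF assms(1)] assms(2) x False by auto
  have "x - 1 \<le> x" "1 \<le> x - 1" using x False by auto
  then have "hook_length D (x, y) + x \<le> hook_length D (x - 1, y) + (x - 1)"
    using hook_length_below[OF assms(1,2)] by blast
  then have "\<not> hook_length D (x - 1, y) \<le> k" using assms(3) x by linarith
  then show ?thesis
    using hook_le_iff_cs[OF assms(1,2), of k] hook_le_iff_cs[OF assms(1) mem, of k] assms(3) x by simp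
qed

lemma hook_eq_rs:
  assumes "is_diagram D" "(x, y) \<in> D" "hook_length D (x, y) = k"
  shows "row_count D x + 1 = rs k D x + y"
  using hook_eq_cs[of "D\<inverse>" y x k] assms
  by (simp add: hook_length_converse col_count_converse cs_converse)

lemma finite_support_cs:
  assumes "is_diagram D"
  shows "finite {y. 1 \<le> y \<and> cs k D y \<noteq> 0}"
proof (rule finite_subset)
  show "{y. 1 \<le> y \<and> cs k D y \<noteq> 0} \<subseteq> {..row_count D 1}"
  proof (clarsimp)
    fix y assume "Suc 0 \<le> y" "0 < cs k D y"
    then show "y \<le> row_count D (Suc 0)"
      using cs_le_col_count[OF assms, of k y] row_le_iff_col_le[OF assms, of 1 y] by simp
  qed
qed simp

lemma kshapesD:
  assumes "D \<in> kshapes k"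
  shows "is_diagram D" and "1 \<le> i \<Longrightarrow> i \<le> j \<Longrightarrow> rs k D j \<le> rs k D i"
    and "1 \<le> i \<Longrightarrow> i \<le> j \<Longrightarrow> cs k D j \<le> cs k D i"
  using assms is_partition_mono[of "rs k D"] is_partition_mono[of "cs k D"]
  unfolding kshapes_def by blast+

text \<open>The top cell of the last column has hook length one, and the column sizes decrease weakly, so
  every column of a \<open>k\<close>-shape meets the boundary.\<close>

lemma cs_pos:
  assumes "D \<in> kshapes k" "1 \<le> k" "1 \<le> y" "y \<le> row_count D 1"
  shows "1 \<le> cs k D y"
proof -
  note D = kshapesD(1)[OF assms(1)]
  let ?Y = "row_count D 1" and ?X = "col_count D (row_count D 1)"
  have X: "1 \<le> ?X" using row_le_iff_col_le[OF D, of 1 ?Y] assms by simp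
  then have "?Y \<le> row_count D ?X" using row_le_iff_col_le[OF D, of ?X ?Y] assms by simp
  moreover have "row_count D ?X \<le> ?Y" using row_count_mono[OF D, of 1 ?X] X by simp
  moreover have mem: "(?X, ?Y) \<in> D" using mem_diagram_col[OF D] X assms by simp
  ultimately have "hook_length D (?X, ?Y) \<le> k" using hook_length_add[OF D mem] assms(2) by simp
  then have "1 \<le> cs k D ?Y" using hook_le_iff_cs[OF D mem] by simp
  then show ?thesis using kshapesD(3)[OF assms(1,3,4)] by simp
qed

section \<open>A string changes hook lengths from \<open>k\<close> to \<open>k + 1\<close>\<close>

text \<open>The cells of the string lie in distinct rows, weakly below the row of
  \<open>b\<^sub>0\<close>. The cells weakly below \<open>b\<^sub>0\<close> in its column belong to
  \<open>D\<close> already, so only the row of \<open>b\<^sub>0\<close> grows, by one cell.\<close>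

lemma row_type_string_hooks:
  assumes "row_type_string k D E as"
  shows "\<exists>b\<in>D. b \<in> E \<and> hook_length D b = k \<and> hook_length E b = k + 1"
proof -
  from assms obtain b0 where str: "is_string k D E as"
    and left: "leftmost_in_row (boundary k D) (row (hd as)) b0"
    and lost: "b0 \<in> boundary k D - boundary k E"
    unfolding row_type_string_def by blast
  from str have D: "is_diagram D" and E: "is_diagram E" and DE: "D \<subseteq> E" and new: "E - D = set as"
    and ne: "as \<noteq> []"
    and dec: "\<And>i. Suc i < length as \<Longrightarrow> row (as ! Suc i) < row (as ! i)"
    unfolding is_string_def by auto
  obtain x y where b0: "b0 = (x, y)" by (cases b0)
  have x: "x = row (hd as)" using left b0 unfolding leftmost_in_row_def by simp
  have below: "row (as ! i) < x" if "0 < i" "i < length as" for i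
    using that
  proof (induction i)
    case (Suc i)
    then show ?case using dec[of i] ne x by (cases "i = 0") (auto simp: hd_conv_nth)
  qed simp
  have mem: "(x, y) \<in> D" using lost b0 unfolding boundary_def by auto
  have col: "{i. (i, y) \<in> E} = {i. (i, y) \<in> D}"
  proof (rule ccontr)
    assume "\<not> ?thesis"
    then obtain i where i: "(i, y) \<in> E - D" using DE by auto
    then obtain j where j: "j < length as" "as ! j = (i, y)" using new by (metis in_set_conv_nth)
    have "i \<le> x" using below[of j] j ne x by (cases "j = 0") (auto simp: hd_conv_nth)
    moreover have "1 \<le> i" using i mem_diagram_row[OF E] by auto
    ultimately have "(i, y) \<in> D" using diagram_down[OF D mem] mem mem_diagram_row[OF D] by auto
    then show False using i by simp
  qed
  have "{j. (x, j) \<in> E} = insert (col (hd as)) {j. (x, j) \<in> D}"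
  proof (intro set_eqI iffI)
    fix j assume j: "j \<in> {j. (x, j) \<in> E}"
    show "j \<in> insert (col (hd as)) {j. (x, j) \<in> D}"
    proof (cases "(x, j) \<in> D")
      case False
      then obtain n where n: "n < length as" "as ! n = (x, j)" using new j
        by (metis DiffI in_set_conv_nth mem_Collect_eq)
      then have "n = 0" using below[of n] by fastforce
      then show ?thesis using n ne by (simp add: hd_conv_nth)
    qed simp
  next
    fix j assume "j \<in> insert (col (hd as)) {j. (x, j) \<in> D}"
    moreover have "(x, col (hd as)) \<in> E" using new ne x by (metis DiffD1 hd_in_set prod.collapse)
    ultimately show "j \<in> {j. (x, j) \<in> E}" using DE by auto
  qed
  moreover have "(x, col (hd as)) \<notin> D" using new ne x by (metis DiffD2 hd_in_set prod.collapse)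
  moreover have "finite {j. (x, j) \<in> D}"
    by (rule finite_subset[OF _ finite_imageI[OF finite_diagram[OF D], of snd]]) force
  ultimately have "row_count E x = row_count D x + 1" by (simp add: row_count_def)
  moreover have "col_count E y = col_count D y" using col by (simp add: col_count_def)
  moreover have memE: "(x, y) \<in> E" using mem DE by auto
  ultimately have "hook_length E (x, y) = hook_length D (x, y) + 1"
    using hook_length_add[OF D mem] hook_length_add[OF E memE] by simp
  moreover have "hook_length D (x, y) \<le> k" "k < hook_length E (x, y)"
    using lost memE b0 unfolding boundary_def by auto
  ultimately show ?thesis using mem memE by force
qed

lemma row_move_hooks:
  assumes "row_move k r l D E" "1 \<le> r"
  shows "\<exists>b\<in>D. hook_length D b = k" and "\<exists>b\<in>E. hook_length E b = k + 1"
proof -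
  from assms(1) obtain C s where C: "C 0 = D" "C r = E"
    and str: "\<forall>i<r. row_type_string k (C i) (C (Suc i)) (s i) \<and> length (s i) = l"
    unfolding row_move_def by (elim conjE exE)
  show "\<exists>b\<in>D. hook_length D b = k"
    using row_type_string_hooks[of k "C 0" "C (Suc 0)" "s 0"] str assms(2) C(1) by fastforce
  show "\<exists>b\<in>E. hook_length E b = k + 1"
    using row_type_string_hooks[of k "C (r - 1)" "C r" "s (r - 1)"] str assms(2) C(2)
    by (metis Suc_diff_1 diff_less less_le_trans zero_less_one)
qed

lemma nonempty_move_hooks:
  assumes "nonempty_move k D E"
  shows "\<exists>b\<in>D. hook_length D b = k" and "\<exists>b\<in>E. hook_length E b = k + 1"
proof -
  from assms obtain r l where r: "1 \<le> r" "row_move k r l D E \<or> row_move k r l (D\<inverse>) (E\<inverse>)"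
    unfolding nonempty_move_def column_move_def by blast
  have swap: "\<exists>b\<in>F. hook_length F b = n" if "\<exists>b\<in>F\<inverse>. hook_length (F\<inverse>) b = n" for F n
  proof -
    from that obtain x y where "(x, y) \<in> F" "hook_length (F\<inverse>) (y, x) = n" by auto
    then show ?thesis using hook_length_converse[of F y x] by (metis)
  qed
  show "\<exists>b\<in>D. hook_length D b = k"
    using r(2)
  proof
    assume "row_move k r l (D\<inverse>) (E\<inverse>)"
    from swap[OF row_move_hooks(1)[OF this r(1)]] show ?thesis .
  qed (rule row_move_hooks(1)[OF _ r(1)])
  show "\<exists>b\<in>E. hook_length E b = k + 1"
    using r(2)
  proof
    assume "row_move k r l (D\<inverse>) (E\<inverse>)"
    from swap[OF row_move_hooks(2)[OF this r(1)]] show ?thesis .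
  qed (rule row_move_hooks(2)[OF _ r(1)])
qed

section \<open>Row moves from parallel strips\<close>

lemma of_bool_disjoint: "\<not> (P \<and> Q) \<Longrightarrow> (of_bool (P \<or> Q) :: nat) = of_bool P + of_bool Q"
  by auto

text \<open>Each row in the list \<open>ps\<close> is to receive \<open>M\<close> cells, one with each
  string. In the notation of the definition of a string, the first string has one cell
  \<open>a\<^sub>i\<close> just beyond the end of each of these rows, \<open>b\<^sub>0\<close> in column
  \<open>c0\<close>, and \<open>b\<^sub>i\<close> is where the row of \<open>a\<^bsub>i+1\<^esub>\<close>
  meets the column of \<open>a\<^sub>i\<close>. The hook of \<open>b\<^sub>i\<close> grows by two, so it
  may have length \<open>k - 1\<close> or \<open>k\<close> at first; this is the first half of
  \<open>link\<close>. The second half makes \<open>b\<^sub>i\<close> the first boundary cell of its row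
  and of its column, also for the later strings, so that no other boundary cell is lost. In the columns of
  the last cells nothing is to be lost, which is \<open>stop\<close>.\<close>

locale strips =
  fixes k M c0 :: nat and D :: diagram and ps :: "nat list"
  assumes D: "is_diagram D"
    and ne: "ps \<noteq> []"
    and dec: "sorted_wrt (>) ps"
    and pos: "\<And>p. p \<in> set ps \<Longrightarrow> 1 \<le> p"
    and room: "\<And>p. p \<in> set ps \<Longrightarrow> 1 < p \<Longrightarrow> row_count D p + M \<le> row_count D (p - 1)"
    and start: "(hd ps, c0) \<in> D" "hook_length D (hd ps, c0) = k"
    and heights: "\<And>j. j < M \<Longrightarrow> col_count D (c0 + j) = col_count D c0"
    and link: "\<And>i. Suc i < length ps \<Longrightarrow> k \<le> hook_length D (ps ! Suc i, row_count D (ps ! i) + 1) + 1"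
      "\<And>i. Suc i < length ps \<Longrightarrow> hook_length D (ps ! Suc i, row_count D (ps ! i) + 1) \<le> k"
      "\<And>i. Suc i < length ps \<Longrightarrow> k < hook_length D (ps ! Suc i, row_count D (ps ! i))"
      "\<And>i. Suc i < length ps \<Longrightarrow> 1 < ps ! Suc i \<Longrightarrow>
         k < hook_length D (ps ! Suc i - 1, row_count D (ps ! i) + M)"
    and stop: "\<And>x n. n < M \<Longrightarrow> (x, row_count D (last ps) + Suc n) \<in> D \<Longrightarrow>
         hook_length D (x, row_count D (last ps) + Suc n) \<noteq> k"
begin

abbreviation rw :: "nat \<Rightarrow> nat" where "rw \<equiv> row_count D"
abbreviation ht :: "nat \<Rightarrow> nat" where "ht \<equiv> col_count D"

definition filled :: "nat \<Rightarrow> diagram" where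
  "filled n = D \<union> {(x, y). x \<in> set ps \<and> rw x < y \<and> y \<le> rw x + n}"

lemma dec_nth: "i < j \<Longrightarrow> j < length ps \<Longrightarrow> ps ! j < ps ! i"
  using dec by (simp add: sorted_wrt_iff_nth_less)

lemma nth_pos: "i < length ps \<Longrightarrow> 1 \<le> ps ! i"
  using pos by simp

lemma ps_nthE:
  assumes "p \<in> set ps"
  obtains i where "i < length ps" "p = ps ! i"
  using assms by (auto simp: in_set_conv_nth)

text \<open>By \<open>room\<close>, the rows below a row of the list are longer by at least
  \<open>M\<close>, so the strips occupy disjoint sets of columns.\<close>

lemma strips_right:
  assumes "p \<in> set ps" "q < p" "1 \<le> q"
  shows "rw p + M \<le> rw q"
proof -
  have "rw (p - 1) \<le> rw q" using assms D by (intro row_count_mono) auto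
  then show ?thesis using room[OF assms(1)] assms by simp
qed

lemma in_strip_unique:
  assumes "p \<in> set ps" "q \<in> set ps" "rw p < y" "y \<le> rw p + M" "rw q < y" "y \<le> rw q + M"
  shows "p = q"
proof (rule ccontr)
  assume "p \<noteq> q"
  then consider "p < q" | "q < p" by linarith
  then show False
    using strips_right[OF assms(1), of q] strips_right[OF assms(2), of p] assms pos by cases force+
qed

lemma ht_strip:
  assumes "p \<in> set ps" "rw p < y" "y \<le> rw p + M"
  shows "ht y = p - 1"
proof -
  have p: "1 \<le> p" "1 \<le> y" using pos assms by auto
  have "\<not> p \<le> ht y" using row_le_iff_col_le[OF D p] assms by simp
  moreover have "p - 1 \<le> ht y"
  proof (cases "p = 1")
    case False
    then show ?thesis using row_le_iff_col_le[OF D, of "p - 1" y] room[OF assms(1)] assms p by simp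
  qed simp
  ultimately show ?thesis by simp
qed

lemma mem_filled:
  "(x, y) \<in> filled n \<longleftrightarrow> 1 \<le> x \<and> 1 \<le> y \<and> y \<le> rw x + (if x \<in> set ps then n else 0)"
  unfolding filled_def using mem_diagram_row[OF D, of x y] pos by auto

lemma rw_filled_mono:
  assumes "n \<le> M" "1 \<le> x'" "x' \<le> x"
  shows "rw x + (if x \<in> set ps then n else 0) \<le> rw x' + (if x' \<in> set ps then n else 0)"
proof (cases "x \<in> set ps \<and> x' < x")
  case True
  then show ?thesis using strips_right[of x x'] assms by simp
next
  case False
  then show ?thesis using row_count_mono[OF D assms(2,3)] assms(3) by auto
qed

lemma is_diagram_filled:
  assumes "n \<le> M"
  shows "is_diagram (filled n)"
proof (rule is_diagramI)
  have "{(x, y). x \<in> set ps \<and> rw x < y \<and> y \<le> rw x + n} \<subseteq> Sigma (set ps) (\<lambda>x. {..rw x + n})"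
    by auto
  then have "finite {(x, y). x \<in> set ps \<and> rw x < y \<and> y \<le> rw x + n}"
    by (rule finite_subset) auto
  then show "finite (filled n)" unfolding filled_def using finite_diagram[OF D] by simp
  show "1 \<le> x \<and> 1 \<le> y" if "(x, y) \<in> filled n" for x y using that mem_filled by simp
  show "(x', y') \<in> filled n"
    if "(x, y) \<in> filled n" "1 \<le> x'" "x' \<le> x" "1 \<le> y'" "y' \<le> y" for x y x' y'
    using that rw_filled_mono[OF assms, of x' x] by (simp add: mem_filled)
qed

lemma row_count_filled: "1 \<le> x \<Longrightarrow> row_count (filled n) x = rw x + (if x \<in> set ps then n else 0)"
proof -
  assume "1 \<le> x"
  then have "{j. (x, j) \<in> filled n} = {1..rw x + (if x \<in> set ps then n else 0)}"
    using mem_filled by auto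
  then show ?thesis unfolding row_count_def[of "filled n"] by simp
qed

lemma col_count_filled:
  assumes "n \<le> M" "1 \<le> y"
  shows "col_count (filled n) y = ht y + of_bool (\<exists>p\<in>set ps. rw p < y \<and> y \<le> rw p + n)"
proof (cases "\<exists>p\<in>set ps. rw p < y \<and> y \<le> rw p + n")
  case True
  then obtain p where p: "p \<in> set ps" "rw p < y" "y \<le> rw p + n" by blast
  have "q = p" if "q \<in> set ps" "rw q < y" "y \<le> rw q + n" for q
    using in_strip_unique[OF that(1) p(1) that(2)] that(3) p assms(1) by simp
  then have "{i. (i, y) \<in> filled n} = insert p {i. (i, y) \<in> D}"
    unfolding filled_def using p by blast
  moreover have "{i. (i, y) \<in> D} = {1..ht y}" using mem_diagram_col[OF D] assms by auto
  ultimately have "{i. (i, y) \<in> filled n} = {1..p}"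
    using ht_strip[OF p(1,2)] p assms pos[OF p(1)] by auto
  then show ?thesis using True ht_strip[OF p(1,2)] p assms pos[OF p(1)]
    unfolding col_count_def[of "filled n"] by simp
next
  case False
  then have "{i. (i, y) \<in> filled n} = {i. (i, y) \<in> D}" unfolding filled_def by auto
  then show ?thesis using False unfolding col_count_def by (simp add: filled_def)
qed

lemma hook_filled:
  assumes "n \<le> M" "(x, y) \<in> filled n"
  shows "hook_length (filled n) (x, y) + x + y = rw x + (if x \<in> set ps then n else 0) + ht y
    + of_bool (\<exists>p\<in>set ps. rw p < y \<and> y \<le> rw p + n) + 1"
  using hook_length_add[OF is_diagram_filled[OF assms(1)] assms(2)] assms mem_filled[of x y n]
  by (simp add: row_count_filled col_count_filled)

lemma filled_0: "filled 0 = D"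
  unfolding filled_def by auto

definition new_cells :: "nat \<Rightarrow> cell list" where
  "new_cells n = map (\<lambda>p. (p, rw p + Suc n)) ps"

definition lost_cells :: "nat \<Rightarrow> cell set" where
  "lost_cells n = insert (hd ps, c0 + n) {(ps ! Suc i, rw (ps ! i) + Suc n) | i. Suc i < length ps}"

lemma filled_Suc: "filled (Suc n) = filled n \<union> set (new_cells n)"
  unfolding filled_def new_cells_def by (auto simp: less_Suc_eq_le le_Suc_eq)

lemma new_not_filled: "filled n \<inter> set (new_cells n) = {}"
  unfolding filled_def new_cells_def using mem_diagram_row[OF D] by auto

lemma hook_Suc:
  assumes "n < M" "(x, y) \<in> filled n"
  shows "hook_length (filled (Suc n)) (x, y) =
    hook_length (filled n) (x, y) + of_bool (x \<in> set ps) + of_bool (\<exists>p\<in>set ps. y = rw p + Suc n)"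
proof -
  have mem: "(x, y) \<in> filled (Suc n)" using assms(2) filled_Suc by auto
  have ex: "(\<exists>p\<in>set ps. rw p < y \<and> y \<le> rw p + Suc n) \<longleftrightarrow>
      (\<exists>p\<in>set ps. rw p < y \<and> y \<le> rw p + n) \<or> (\<exists>p\<in>set ps. y = rw p + Suc n)"
    using less_Suc_eq_le by (metis add_Suc_right le_SucI le_Suc_eq le_add1)
  have "\<not> ((\<exists>p\<in>set ps. rw p < y \<and> y \<le> rw p + n) \<and> (\<exists>p\<in>set ps. y = rw p + Suc n))"
  proof
    assume "(\<exists>p\<in>set ps. rw p < y \<and> y \<le> rw p + n) \<and> (\<exists>p\<in>set ps. y = rw p + Suc n)"
    then obtain p q where "p \<in> set ps" "rw p < y" "y \<le> rw p + n" "q \<in> set ps" "y = rw q + Suc n"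
      by blast
    moreover from this have "p = q" using in_strip_unique[of p q y] assms(1) by simp
    ultimately show False by simp
  qed
  then have "(of_bool (\<exists>p\<in>set ps. rw p < y \<and> y \<le> rw p + Suc n) :: nat) =
      of_bool (\<exists>p\<in>set ps. rw p < y \<and> y \<le> rw p + n) + of_bool (\<exists>p\<in>set ps. y = rw p + Suc n)"
    unfolding ex by (rule of_bool_disjoint)
  moreover have "(if x \<in> set ps then Suc n else 0) = (if x \<in> set ps then n else 0) + of_bool (x \<in> set ps)"
    by simp
  ultimately show ?thesis
    using hook_filled[OF less_imp_le[OF assms(1)] assms(2)] hook_filled[OF Suc_leI[OF assms(1)] mem]
    by linarith
qed

lemma le_rw_hd: "j < M \<Longrightarrow> c0 + j \<le> rw (hd ps)"
  using row_le_iff_col_le[OF D, of "hd ps" "c0 + j"] heights[of j] start(1) mem_diagram_col[OF D]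
  by auto

text \<open>The \<open>n\<close> cells added to the row of \<open>a\<^sub>1\<close> push the hook length
  \<open>k\<close> from column \<open>c0\<close> to column \<open>c0 + n\<close>, because the columns in
  between have equal heights.\<close>

lemma hook_first:
  assumes "n < M"
  shows "(hd ps, c0 + n) \<in> filled n" "hook_length (filled n) (hd ps, c0 + n) = k"
    "\<not> (\<exists>p\<in>set ps. c0 + n = rw p + Suc n)"
proof -
  have hd: "hd ps \<in> set ps" "1 \<le> c0" using ne start(1) mem_diagram_row[OF D] by auto
  have le: "c0 + n \<le> rw (hd ps)" by (rule le_rw_hd[OF assms])
  have ge: "rw (hd ps) \<le> rw p" if "p \<in> set ps" for p
  proof -
    obtain i where i: "i < length ps" "p = ps ! i" using \<open>p \<in> set ps\<close> by (rule ps_nthE)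
    then have "p \<le> hd ps" using dec_nth[of 0 i] ne by (cases "i = 0") (auto simp: hd_conv_nth)
    then show ?thesis using row_count_mono[OF D pos[OF that]] by simp
  qed
  have lt: "\<not> rw p < c0 + n" if "p \<in> set ps" for p using ge[OF that] le by simp
  show "\<not> (\<exists>p\<in>set ps. c0 + n = rw p + Suc n)"
  proof
    assume "\<exists>p\<in>set ps. c0 + n = rw p + Suc n"
    then obtain p where "p \<in> set ps" "c0 + n = rw p + Suc n" by blast
    then show False using lt[of p] by simp
  qed
  show mem: "(hd ps, c0 + n) \<in> filled n" using mem_filled le hd pos by simp
  have "(\<exists>p\<in>set ps. rw p < c0 + n \<and> c0 + n \<le> rw p + n) = False"
    using lt by blast
  then have "hook_length (filled n) (hd ps, c0 + n) + hd ps + (c0 + n) = rw (hd ps) + n + ht (c0 + n) + 0 + 1"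
    using hook_filled[OF less_imp_le[OF assms] mem] hd(1) by (simp only: if_True of_bool_eq)
  then show "hook_length (filled n) (hd ps, c0 + n) = k"
    using hook_length_add[OF D start(1)] start(2) heights[OF assms] by simp
qed

text \<open>The cell \<open>b\<^sub>i\<close> moves right by one column with each string while its row
  grows by one cell, so its hook length is the same for every \<open>n\<close>. The last equation gives the
  contiguity of \<open>a\<^sub>i\<close> and \<open>a\<^bsub>i+1\<^esub>\<close>: their diagonals differ by
  one more than the hook length of \<open>b\<^sub>i\<close>.\<close>

lemma hook_link:
  assumes "n < M" "Suc i < length ps" and y: "y = rw (ps ! i) + Suc n"
  shows "(ps ! Suc i, y) \<in> filled n"
    "hook_length (filled n) (ps ! Suc i, y) = hook_length D (ps ! Suc i, rw (ps ! i) + 1)"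
    "k \<le> hook_length (filled n) (ps ! Suc i, y) + 1" "hook_length (filled n) (ps ! Suc i, y) \<le> k"
    "1 \<le> y' \<Longrightarrow> y' < y \<Longrightarrow> k < hook_length (filled n) (ps ! Suc i, y')"
    "1 \<le> x \<Longrightarrow> x < ps ! Suc i \<Longrightarrow> k < hook_length (filled n) (x, y)"
    "hook_length D (ps ! Suc i, rw (ps ! i) + 1) + ps ! Suc i + rw (ps ! i) + 1 =
      rw (ps ! Suc i) + ps ! i"
proof -
  define p q where "p = ps ! i" and "q = ps ! Suc i"
  have pq: "p \<in> set ps" "q \<in> set ps" "q < p" "1 \<le> q"
    using dec_nth[of i "Suc i"] pos assms(2) unfolding p_def q_def by auto
  have wide: "rw p + M \<le> rw q" using strips_right pq by simp
  have y: "y = rw p + Suc n" using y p_def by simp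
  have memD: "(q, rw p + Suc j) \<in> D" if "j < M" for j
    using mem_diagram_row[OF D] pq wide that by simp
  have ht: "ht (rw p + Suc j) = p - 1" if "j < M" for j
    using ht_strip[OF pq(1)] that by simp
  have h: "hook_length D (q, rw p + 1) + q + rw p + 1 = rw q + p"
    using hook_length_add[OF D memD[of 0]] ht[of 0] assms(1) pq by simp
  then show "hook_length D (ps ! Suc i, rw (ps ! i) + 1) + ps ! Suc i + rw (ps ! i) + 1 =
      rw (ps ! Suc i) + ps ! i" unfolding p_def q_def .
  have mem: "(q, y) \<in> filled n" using memD[OF assms(1)] y unfolding filled_def by simp
  then show "(ps ! Suc i, y) \<in> filled n" unfolding q_def .
  have diag: "is_diagram (filled n)" using is_diagram_filled assms(1) by simp
  have "\<not> (rw p' < y \<and> y \<le> rw p' + n)" if "p' \<in> set ps" for p'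
    using in_strip_unique[of p' p y] that pq(1) y assms(1) by auto
  then have "(\<exists>p'\<in>set ps. rw p' < y \<and> y \<le> rw p' + n) = False" by blast
  then have "hook_length (filled n) (q, y) + q + y = rw q + n + ht y + 0 + 1"
    using hook_filled[OF less_imp_le[OF assms(1)] mem] pq(2) by (simp only: if_True of_bool_eq)
  then have hq: "hook_length (filled n) (q, y) = hook_length D (q, rw p + 1)"
    using h ht[OF assms(1)] y pq by simp
  then show "hook_length (filled n) (ps ! Suc i, y) = hook_length D (ps ! Suc i, rw (ps ! i) + 1)"
    unfolding p_def q_def .
  then show lower: "k \<le> hook_length (filled n) (ps ! Suc i, y) + 1"
    and "hook_length (filled n) (ps ! Suc i, y) \<le> k"
    using link(1,2)[OF assms(2)] by simp_all
  show "k < hook_length (filled n) (ps ! Suc i, y')" if y': "1 \<le> y'" "y' < y"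
  proof -
    have memy: "(q, y - 1) \<in> filled n"
      using diagram_down[OF diag mem] pq y' by simp
    have "k < hook_length (filled n) (q, y - 1)"
    proof (cases n)
      case 0
      then show ?thesis using link(3)[OF assms(2)] y filled_0 unfolding p_def q_def by simp
    next
      case (Suc j)
      then have "(\<exists>p\<in>set ps. rw p < y - 1 \<and> y - 1 \<le> rw p + n) = True" using pq(1) y by force
      moreover have "ht (y - 1) = p - 1" using ht[of j] Suc assms(1) y by simp
      ultimately have "hook_length (filled n) (q, y - 1) + q + (y - 1) = rw q + n + (p - 1) + 1 + 1"
        using hook_filled[OF less_imp_le[OF assms(1)] memy] pq(2) by (simp only: if_True of_bool_eq)
      then show ?thesis using h y lower hq pq unfolding q_def[symmetric] by simp
    qed
    moreover have "y' \<le> y - 1" using y' by simp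
    ultimately show ?thesis using hook_length_left[OF diag memy y'(1)] unfolding q_def by linarith
  qed
  show "k < hook_length (filled n) (x, y)" if x: "1 \<le> x" "x < ps ! Suc i"
  proof -
    have xq: "x < q" using x q_def by simp
    have wide': "rw p + M \<le> rw (q - 1)" using strips_right[OF pq(1), of "q - 1"] pq xq x by simp
    have memM: "(q - 1, rw p + M) \<in> D"
      using mem_diagram_row[OF D] wide' xq x assms(1) by simp
    have mem1: "(q - 1, y) \<in> D" using mem_diagram_row[OF D] wide' xq x assms(1) y by simp
    have memx: "(x, y) \<in> D" using diagram_down[OF D mem1, of x y] xq x y by simp
    have "k < hook_length D (q - 1, rw p + M)"
      using link(4)[OF assms(2)] xq x unfolding p_def q_def by simp
    also have "\<dots> \<le> hook_length D (q - 1, y)"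
      using hook_length_left[OF D memM, of y] y assms(1) by simp
    also have "\<dots> \<le> hook_length D (x, y)"
    proof -
      have "x \<le> q - 1" using xq by simp
      then show ?thesis using hook_length_below[OF D mem1 x(1)] by linarith
    qed
    also have "\<dots> \<le> hook_length (filled n) (x, y)"
    proof -
      have "(x, y) \<in> filled n" using memx unfolding filled_def by simp
      then show ?thesis
        using hook_length_add[OF D memx] hook_filled[OF less_imp_le[OF assms(1)], of x y] by linarith
    qed
    finally show ?thesis .
  qed
qed

text \<open>A hook grows by one if its corner lies in the row or in the column of a new cell, and by two
  if both hold. Other than at the listed cells, a growing hook is longer than \<open>k\<close> already or
  stays at most \<open>k\<close>: in the new columns by \<open>link\<close> and \<open>stop\<close>,
  elsewhere in the rows because hook lengths decrease strictly along a row.\<close>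

lemma lost_cells_eq:
  assumes n: "n < M"
  shows "boundary k (filled n) - boundary k (filled (Suc n)) = lost_cells n"
proof (intro set_eqI iffI)
  fix b assume "b \<in> lost_cells n"
  then consider "b = (hd ps, c0 + n)"
    | i where "Suc i < length ps" "b = (ps ! Suc i, rw (ps ! i) + Suc n)"
    unfolding lost_cells_def by blast
  then show "b \<in> boundary k (filled n) - boundary k (filled (Suc n))"
  proof cases
    case 1
    then show ?thesis
      using hook_first[OF n] hook_Suc[OF n hook_first(1)[OF n]] ne unfolding boundary_def by simp
  next
    case 2
    note L = hook_link[OF n 2(1) refl]
    have "ps ! i \<in> set ps" using 2(1) by simp
    then have "\<exists>p\<in>set ps. rw (ps ! i) + Suc n = rw p + Suc n" by blast
    then have "hook_length (filled (Suc n)) b = hook_length (filled n) b + 2"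
      using hook_Suc[OF n L(1)] 2 by simp
    then show ?thesis using L(1,3,4) 2(2) unfolding boundary_def by simp
  qed
next
  fix b assume b: "b \<in> boundary k (filled n) - boundary k (filled (Suc n))"
  obtain x y where xy: "b = (x, y)" by (cases b)
  have mem: "(x, y) \<in> filled n" and le: "hook_length (filled n) (x, y) \<le> k"
    using b xy unfolding boundary_def by auto
  have gt: "k < hook_length (filled (Suc n)) (x, y)"
    using b mem filled_Suc xy unfolding boundary_def by auto
  have diag: "is_diagram (filled n)" using is_diagram_filled n by simp
  have xy1: "1 \<le> x" "1 \<le> y" using mem mem_filled by auto
  note Suc = hook_Suc[OF n mem]
  show "b \<in> lost_cells n"
  proof (cases "\<exists>p\<in>set ps. y = rw p + Suc n")
    case True
    then obtain i where i: "i < length ps" "y = rw (ps ! i) + Suc n" using ps_nthE by metis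
    have xi: "x < ps ! i"
    proof (rule ccontr)
      assume "\<not> x < ps ! i"
      then have "(ps ! i, y) \<in> filled n" using diagram_down[OF diag mem, of "ps ! i" y] nth_pos[OF i(1)] xy1 by simp
      then show False using mem_filled i by simp
    qed
    show ?thesis
    proof (cases "Suc i < length ps")
      case False
      then have last: "ps ! i = last ps" using i ne by (metis Suc_lessI last_conv_nth diff_Suc_1)
      have xps: "x \<notin> set ps"
      proof
        assume "x \<in> set ps"
        then obtain j where j: "j < length ps" "x = ps ! j" by (rule ps_nthE)
        then have "j \<le> i" using False by simp
        then show False using dec_nth[of j i] i j xi by (cases "j = i") auto
      qed
      then have memD: "(x, y) \<in> D" using mem unfolding filled_def by auto
      have "hook_length (filled n) (x, y) = k" using Suc xps True le gt by simp
      moreover have "\<not> (rw p < y \<and> y \<le> rw p + n)" if "p \<in> set ps" for p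
        using in_strip_unique[of p "ps ! i" y] that i n by auto
      then have "(\<exists>p\<in>set ps. rw p < y \<and> y \<le> rw p + n) = False" by blast
      then have "hook_length (filled n) (x, y) + x + y = rw x + 0 + ht y + 0 + 1"
        using hook_filled[OF less_imp_le[OF n] mem] xps by (simp only: if_False of_bool_eq)
      ultimately have "hook_length D (x, y) = k"
        using hook_length_add[OF D memD] by simp
      then show ?thesis using stop[OF n] memD i last by metis
    next
      case True
      note L = hook_link[OF n True i(2)]
      consider "x = ps ! Suc i" | "ps ! Suc i < x" | "x < ps ! Suc i" by linarith
      then show ?thesis
      proof cases
        case 1
        then show ?thesis using True i xy unfolding lost_cells_def by blast
      next
        case 2
        have "x \<notin> set ps"
        proof
          assume "x \<in> set ps"
          then obtain j where j: "j < length ps" "x = ps ! j" by (rule ps_nthE)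
          then have "i < j" using xi dec_nth[of j i] i by (metis linorder_cases less_asym less_irrefl)
          then show False using dec_nth[of "Suc i" j] j 2 by (cases "j = Suc i") auto
        qed
        moreover have "hook_length (filled n) (x, y) < k"
          using hook_length_below[OF diag mem, of "ps ! Suc i"] L(4) nth_pos[OF True] 2 by simp
        ultimately show ?thesis using Suc gt by (simp add: of_bool_def split: if_splits)
      next
        case 3
        then show ?thesis using L(6)[of x] xy1 le by simp
      qed
    qed
  next
    case False
    then have x: "x \<in> set ps" and hk: "hook_length (filled n) (x, y) = k"
      using Suc le gt by (auto simp: of_bool_def split: if_splits)
    obtain i where i: "i < length ps" "x = ps ! i" using x by (rule ps_nthE)
    show ?thesis
    proof (cases i)
      case 0
      then have xhd: "x = hd ps" using i ne by (simp add: hd_conv_nth)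
      have "1 \<le> c0" using start(1) mem_diagram_row[OF D] by auto
      then have "y = c0 + n"
        using hook_length_left[OF diag mem, of "c0 + n"]
          hook_length_left[OF diag hook_first(1)[OF n], of y] hook_first(2)[OF n] hk xy1 xhd
        by (cases "y \<le> c0 + n") auto
      then show ?thesis using xhd xy unfolding lost_cells_def by simp
    next
      case (Suc j)
      note L = hook_link[OF n i(1)[unfolded Suc] refl]
      have "ps ! j \<in> set ps" using i Suc by simp
      then have "y \<noteq> rw (ps ! j) + Suc n" using False by blast
      moreover have "\<not> y < rw (ps ! j) + Suc n" using L(5)[OF xy1(2)] le i(2) Suc by auto
      ultimately have "hook_length (filled n) (x, y) < k"
        using hook_length_left[OF diag mem, of "rw (ps ! j) + Suc n"] L(4) i(2) Suc by simp
      then show ?thesis using hk by simp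
    qed
  qed
qed

lemma k_pos: "1 \<le> k"
  using start(2) unfolding hook_length_def by simp

lemma boundary_filled_Suc:
  assumes n: "n < M"
  shows "boundary k (filled (Suc n)) = (boundary k (filled n) - lost_cells n) \<union> set (new_cells n)"
    "lost_cells n \<subseteq> boundary k (filled n)"
    "boundary k (filled n) \<inter> set (new_cells n) = {}"
proof -
  show "lost_cells n \<subseteq> boundary k (filled n)" using lost_cells_eq[OF n] by blast
  show "boundary k (filled n) \<inter> set (new_cells n) = {}"
    using new_not_filled unfolding boundary_def by blast
  have "set (new_cells n) \<subseteq> boundary k (filled (Suc n))"
  proof
    fix b assume "b \<in> set (new_cells n)"
    then obtain p where p: "p \<in> set ps" and b: "b = (p, rw p + Suc n)" unfolding new_cells_def by auto
    have mem: "(p, rw p + Suc n) \<in> filled (Suc n)" using mem_filled p pos by simp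
    have "\<exists>q\<in>set ps. rw q < rw p + Suc n \<and> rw p + Suc n \<le> rw q + Suc n" using p by force
    then have "hook_length (filled (Suc n)) (p, rw p + Suc n) = 1"
      using hook_filled[OF _ mem] ht_strip[OF p, of "rw p + Suc n"] p pos[OF p] n by simp
    then show "b \<in> boundary k (filled (Suc n))" using mem b k_pos unfolding boundary_def by simp
  qed
  moreover have "b \<in> boundary k (filled n)" if "b \<in> boundary k (filled (Suc n))" "b \<notin> set (new_cells n)" for b
  proof -
    obtain x y where b: "b = (x, y)" by (cases b)
    have mem: "(x, y) \<in> filled n" using that b filled_Suc unfolding boundary_def by auto
    then show ?thesis using that b hook_Suc[OF n mem] unfolding boundary_def by simp
  qed
  ultimately show "boundary k (filled (Suc n)) = (boundary k (filled n) - lost_cells n) \<union> set (new_cells n)"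
    using lost_cells_eq[OF n] by blast
qed

lemma row_type_string_filled:
  assumes n: "n < M"
  shows "row_type_string k (filled n) (filled (Suc n)) (new_cells n)"
proof -
  have len: "length (new_cells n) = length ps" unfolding new_cells_def by simp
  have nth: "new_cells n ! i = (ps ! i, rw (ps ! i) + Suc n)" if "i < length ps" for i
    using that unfolding new_cells_def by simp
  have hd: "row (hd (new_cells n)) = hd ps" using ne unfolding new_cells_def by (simp add: hd_map)
  have diag: "is_diagram (filled n)" using is_diagram_filled n by simp
  have "is_string k (filled n) (filled (Suc n)) (new_cells n)"
    unfolding is_string_def
  proof (intro conjI allI impI)
    show "is_diagram (filled n)" "is_diagram (filled (Suc n))" using is_diagram_filled n by simp_all
    show "filled n \<subseteq> filled (Suc n)" "filled (Suc n) - filled n = set (new_cells n)"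
      using filled_Suc new_not_filled by blast+
    show "new_cells n \<noteq> []" using ne unfolding new_cells_def by simp
    fix i assume i: "Suc i < length (new_cells n)"
    then have i': "Suc i < length ps" using len by simp
    show "row (new_cells n ! Suc i) < row (new_cells n ! i)" using dec_nth[of i "Suc i"] i' nth by simp
    show "contiguous k (new_cells n ! i) (new_cells n ! Suc i)"
      using hook_link(7)[OF n i' refl] link(1,2)[OF i'] i'
      unfolding contiguous_def diag_def by (auto simp: nth)
  qed
  moreover have "leftmost_in_row (boundary k (filled n)) (row (hd (new_cells n))) (hd ps, c0 + n)"
    unfolding leftmost_in_row_def hd
  proof (intro conjI ballI impI)
    show "(hd ps, c0 + n) \<in> boundary k (filled n)" using hook_first[OF n] unfolding boundary_def by simp
    fix b assume b: "b \<in> boundary k (filled n)" "row b = hd ps"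
    then have "(hd ps, col b) \<in> filled n" "hook_length (filled n) (hd ps, col b) \<le> k"
      unfolding boundary_def by (metis (no_types, lifting) mem_Collect_eq prod.collapse)+
    then show "col (hd ps, c0 + n) \<le> col b"
      using hook_length_left[OF diag hook_first(1)[OF n], of "col b"] hook_first(2)[OF n] mem_filled
      by (cases "c0 + n \<le> col b") auto
  qed simp
  moreover have "{(row (new_cells n ! Suc i), col (new_cells n ! i)) | i. Suc i < length (new_cells n)} =
      {(ps ! Suc i, rw (ps ! i) + Suc n) | i. Suc i < length ps}"
  proof -
    have "row (new_cells n ! Suc i) = ps ! Suc i \<and> col (new_cells n ! i) = rw (ps ! i) + Suc n"
      if "Suc i < length ps" for i using nth[of i] nth[of "Suc i"] that by simp
    then show ?thesis unfolding len by (intro Collect_cong) (metis (no_types, lifting))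
  qed
  ultimately show ?thesis
    unfolding row_type_string_def lost_cells_eq[OF n] lost_cells_def by auto
qed

lemma distinct_ps: "distinct ps"
  unfolding distinct_conv_nth using dec_nth by (metis less_irrefl linorder_neqE_nat)

text \<open>Every row of \<open>ps\<close> gains the cell \<open>a\<^sub>i\<close> and loses
  \<open>b\<^bsub>i-1\<^esub>\<close>.\<close>

lemma rs_filled_Suc:
  assumes n: "n < M"
  shows "rs k (filled (Suc n)) x = rs k (filled n) x"
proof -
  note B = boundary_filled_Suc[OF n]
  have fin: "finite (boundary k (filled n))"
    using finite_diagram[OF is_diagram_filled[of n]] n unfolding boundary_def by simp
  have new: "row_count (set (new_cells n)) x = of_bool (x \<in> set ps)"
  proof -
    have "{j. (x, j) \<in> set (new_cells n)} = (if x \<in> set ps then {rw x + Suc n} else {})"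
      unfolding new_cells_def by auto
    then show ?thesis unfolding row_count_def[of "set (new_cells n)"] by simp
  qed
  have lost: "row_count (lost_cells n) x = of_bool (x \<in> set ps)"
  proof (cases "x \<in> set ps")
    case True
    then obtain i where i: "i < length ps" "x = ps ! i" by (rule ps_nthE)
    have hd: "hd ps = ps ! 0" using ne by (simp add: hd_conv_nth)
    have eq: "ps ! a = ps ! b \<longleftrightarrow> a = b" if "a < length ps" "b < length ps" for a b
      using distinct_ps that by (simp add: nth_eq_iff_index_eq)
    have "\<exists>y. {j. (x, j) \<in> lost_cells n} = {y}"
    proof (cases i)
      case 0
      then have "{j. (x, j) \<in> lost_cells n} = {c0 + n}"
        unfolding lost_cells_def hd using i eq[of 0] ne by (auto)
      then show ?thesis by blast
    next
      case (Suc m)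
      then have "{j. (x, j) \<in> lost_cells n} = {rw (ps ! m) + Suc n}"
        unfolding lost_cells_def hd using i eq[of i] eq[of i 0] ne by auto
      then show ?thesis by blast
    qed
    then show ?thesis using True unfolding row_count_def by auto
  next
    case False
    then have "{j. (x, j) \<in> lost_cells n} = {}" unfolding lost_cells_def using ne by auto
    then show ?thesis using False unfolding row_count_def by simp
  qed
  show ?thesis
    using row_count_exchange[OF fin _ B(2,3), of x] B(1) new lost unfolding rs_def by simp
qed

text \<open>In the column of \<open>a\<^sub>i\<close> the gain is cancelled by the loss of
  \<open>b\<^sub>i\<close>, except for the last \<open>a\<^sub>i\<close>; only the loss of
  \<open>b\<^sub>0\<close> and the gain of that last cell remain.\<close>

lemma cs_filled_Suc:
  assumes n: "n < M"
  shows "cs k (filled (Suc n)) y + of_bool (y = c0 + n) = cs k (filled n) y + of_bool (y = rw (last ps) + Suc n)"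
proof -
  note B = boundary_filled_Suc[OF n]
  have fin: "finite (boundary k (filled n))"
    using finite_diagram[OF is_diagram_filled[of n]] n unfolding boundary_def by simp
  let ?linked = "\<exists>i. Suc i < length ps \<and> y = rw (ps ! i) + Suc n"
  have uniq: "i = j" if "i < length ps" "j < length ps" "y = rw (ps ! i) + Suc n" "y = rw (ps ! j) + Suc n" for i j
  proof -
    have "ps ! i = ps ! j" using in_strip_unique[of "ps ! i" "ps ! j" y] that n by simp
    then show ?thesis using distinct_ps that by (simp add: nth_eq_iff_index_eq)
  qed
  have "col_count (set (new_cells n)) y = of_bool (\<exists>p\<in>set ps. y = rw p + Suc n)"
  proof (cases "\<exists>p\<in>set ps. y = rw p + Suc n")
    case True
    then obtain p where p: "p \<in> set ps" "y = rw p + Suc n" by blast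
    have "q = p" if "q \<in> set ps" "y = rw q + Suc n" for q
      using in_strip_unique[OF that(1) p(1), of y] that p n by simp
    then have "{i. (i, y) \<in> set (new_cells n)} = {p}" unfolding new_cells_def using p by auto
    then show ?thesis using True unfolding col_count_def by simp
  next
    case False
    then have "{i. (i, y) \<in> set (new_cells n)} = {}" unfolding new_cells_def by auto
    then show ?thesis using False unfolding col_count_def by simp
  qed
  also have "\<dots> = of_bool ?linked + of_bool (y = rw (last ps) + Suc n)"
  proof -
    have last: "last ps = ps ! (length ps - 1)" using ne by (rule last_conv_nth)
    have split: "(\<exists>p\<in>set ps. y = rw p + Suc n) \<longleftrightarrow> ?linked \<or> y = rw (last ps) + Suc n"
    proof
      assume "\<exists>p\<in>set ps. y = rw p + Suc n"
      then obtain i where i: "i < length ps" "y = rw (ps ! i) + Suc n" using ps_nthE by metis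
      show "?linked \<or> y = rw (last ps) + Suc n"
      proof (cases "Suc i < length ps")
        case False
        then have "i = length ps - 1" using i by simp
        then show ?thesis using i last by simp
      qed (use i in blast)
    next
      assume "?linked \<or> y = rw (last ps) + Suc n"
      then show "\<exists>p\<in>set ps. y = rw p + Suc n"
      proof
        assume ?linked
        then obtain i where "Suc i < length ps" "y = rw (ps ! i) + Suc n" by blast
        then show ?thesis by (intro bexI[of _ "ps ! i"]) auto
      next
        assume "y = rw (last ps) + Suc n"
        then show ?thesis using ne by (intro bexI[of _ "last ps"]) auto
      qed
    qed
    have "\<not> (?linked \<and> y = rw (last ps) + Suc n)"
    proof
      assume "?linked \<and> y = rw (last ps) + Suc n"
      then obtain i where "Suc i < length ps" "y = rw (ps ! i) + Suc n" "y = rw (last ps) + Suc n" by blast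
      then show False using uniq[of i "length ps - 1"] last by (cases ps) auto
    qed
    then show ?thesis unfolding split by (rule of_bool_disjoint)
  qed
  finally have new: "col_count (set (new_cells n)) y = of_bool ?linked + of_bool (y = rw (last ps) + Suc n)" .
  have lost: "col_count (lost_cells n) y = of_bool (y = c0 + n) + of_bool ?linked"
  proof (cases ?linked)
    case True
    then obtain i where i: "Suc i < length ps" "y = rw (ps ! i) + Suc n" by blast
    have "y \<noteq> c0 + n" using hook_first(3)[OF n] i nth_mem[of i ps] by auto
    moreover have "j = i" if "Suc j < length ps" "y = rw (ps ! j) + Suc n" for j
      using uniq[of j i] that i by simp
    ultimately have "{i. (i, y) \<in> lost_cells n} = {ps ! Suc i}" unfolding lost_cells_def using i by blast
    then show ?thesis using True \<open>y \<noteq> c0 + n\<close> unfolding col_count_def by simp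
  next
    case False
    then have "{i. (i, y) \<in> lost_cells n} = (if y = c0 + n then {hd ps} else {})"
      unfolding lost_cells_def by auto
    moreover have "?linked = False" using False by blast
    ultimately show ?thesis unfolding col_count_def by (simp only: of_bool_eq) simp
  qed
  show ?thesis
    using col_count_exchange[OF fin _ B(2,3), of y] B(1) new lost unfolding cs_def by simp
qed

lemma rs_filled: "n \<le> M \<Longrightarrow> rs k (filled n) = rs k D"
  by (induction n) (auto simp: filled_0 rs_filled_Suc fun_eq_iff)

lemma cs_filled:
  assumes "n \<le> M"
  shows "cs k (filled n) y + of_bool (c0 \<le> y \<and> y < c0 + n) =
    cs k D y + of_bool (rw (last ps) < y \<and> y \<le> rw (last ps) + n)"
  using assms
proof (induction n)
  case 0
  then show ?case by (simp add: filled_0)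
next
  case (Suc n)
  have "(of_bool (c0 \<le> y \<and> y < c0 + Suc n) :: nat) = of_bool (c0 \<le> y \<and> y < c0 + n) + of_bool (y = c0 + n)"
    by auto
  moreover have "(of_bool (rw (last ps) < y \<and> y \<le> rw (last ps) + Suc n) :: nat) =
      of_bool (rw (last ps) < y \<and> y \<le> rw (last ps) + n) + of_bool (y = rw (last ps) + Suc n)"
    by auto
  ultimately show ?case using Suc cs_filled_Suc[of n y] by linarith
qed

lemma rw_hd_le_last: "rw (hd ps) \<le> rw (last ps)"
proof -
  have "last ps \<le> hd ps"
    using dec_nth[of 0 "length ps - 1"] ne by (cases "length ps = 1") (auto simp: hd_conv_nth last_conv_nth)
  then show ?thesis using row_count_mono[OF D pos] ne by simp
qed

lemma row_move_filled:
  assumes shapes: "D \<in> kshapes k" "filled M \<in> kshapes k"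
    and neg: "\<And>j. j < M \<Longrightarrow> cs k D (c0 + j) = cs k D c0"
    and plus: "\<And>j. j < M \<Longrightarrow> cs k D (rw (last ps) + Suc j) = cs k D (rw (last ps) + 1)"
  shows "row_move k M (length ps) D (filled M)"
proof -
  have neg_value: "cs k (filled i) c = cs k D c0" if "i < M" "cs k (filled (Suc i)) c < cs k (filled i) c" for i c
  proof -
    have c: "c = c0 + i" using cs_filled_Suc[OF that(1), of c] that(2) by (auto split: if_splits simp: of_bool_def)
    then have "\<not> rw (last ps) < c" using le_rw_hd[OF that(1)] rw_hd_le_last by simp
    then show ?thesis using cs_filled[of i c] c that(1) neg[OF that(1)] by simp
  qed
  have pos_value: "cs k (filled i) c = cs k D (rw (last ps) + 1)"
    if "i < M" "cs k (filled (Suc i)) c > cs k (filled i) c" for i c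
  proof -
    have c: "c = rw (last ps) + Suc i" using cs_filled_Suc[OF that(1), of c] that(2) by (auto split: if_splits simp: of_bool_def)
    then have "\<not> c < c0 + i" using le_rw_hd[OF that(1)] rw_hd_le_last by simp
    then show ?thesis using cs_filled[of i c] c that(1) plus[OF that(1)] by simp
  qed
  have diff: "filled (Suc i) - filled i = set (new_cells i)" for i
    using filled_Suc new_not_filled by blast
  have tr: "translates k (filled i) (filled (Suc i)) (filled j) (filled (Suc j))" if "i < M" "j < M" for i j
    unfolding translates_def diff
  proof (intro conjI allI impI)
    show "\<exists>u v. (\<lambda>(i, j). (int i, int j)) ` set (new_cells j) = (\<lambda>(i, j). (int i + u, int j + v)) ` set (new_cells i)"
      by (intro exI[of _ 0] exI[of _ "int j - int i"]) (simp add: new_cells_def image_image)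
  qed (use neg_value[OF that(1)] neg_value[OF that(2)] pos_value[OF that(1)] pos_value[OF that(2)]
        rs_filled_Suc[OF that(1)] rs_filled_Suc[OF that(2)] in auto)
  show ?thesis
    unfolding row_move_def
  proof (intro conjI exI[of _ filled] exI[of _ new_cells] allI impI)
    show "col (hd (new_cells (Suc i))) = Suc (col (hd (new_cells i)))" for i
      using ne unfolding new_cells_def by (simp add: hd_map)
    show "length (new_cells i) = length ps" for i unfolding new_cells_def by simp
  qed (use shapes filled_0 row_type_string_filled tr in auto)
qed

end

section \<open>Sequences of rows in a \<open>k\<close>-shape\<close>

text \<open>Used with \<open>good p\<close> for a row that may be modified, \<open>stop p\<close> for a
  row at which a move may end, and \<open>link p q\<close> for the condition on consecutive rows.\<close>

lemma descending_chain:
  assumes step: "\<And>p. good p \<Longrightarrow> stop p \<or> (\<exists>q<p. good q \<and> link p q)"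
    and "good (p :: nat)"
  shows "\<exists>ps. ps \<noteq> [] \<and> hd ps = p \<and> sorted_wrt (>) ps \<and> (\<forall>q\<in>set ps. good q) \<and>
    (\<forall>i. Suc i < length ps \<longrightarrow> link (ps ! i) (ps ! Suc i)) \<and> stop (last ps)"
  using assms(2)
proof (induction p rule: less_induct)
  case (less p)
  show ?case
  proof (cases "stop p")
    case True
    then show ?thesis using less.prems by (intro exI[of _ "[p]"]) simp
  next
    case False
    then obtain q where q: "q < p" "good q" "link p q" using step[OF less.prems] by blast
    from less.IH[OF q(1,2)] obtain ps where ps: "ps \<noteq> []" "hd ps = q" "sorted_wrt (>) ps"
      "\<forall>q\<in>set ps. good q" "\<forall>i. Suc i < length ps \<longrightarrow> link (ps ! i) (ps ! Suc i)" "stop (last ps)"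
      by blast
    obtain qs where qs: "ps = q # qs" using ps(1,2) by (cases ps) auto
    have "link ((p # ps) ! i) ((p # ps) ! Suc i)" if "Suc i < length (p # ps)" for i
      using ps(5) q(3) qs that by (cases i) auto
    then show ?thesis
      using ps q qs less.prems by (intro exI[of _ "p # ps"]) auto
  qed
qed

locale kshape =
  fixes k :: nat and D :: diagram
  assumes shape: "D \<in> kshapes k" and k_ge_2: "2 \<le> k"
begin

abbreviation rw :: "nat \<Rightarrow> nat" where "rw \<equiv> row_count D"
abbreviation ht :: "nat \<Rightarrow> nat" where "ht \<equiv> col_count D"
abbreviation row_size :: "nat \<Rightarrow> nat" where "row_size \<equiv> rs k D"
abbreviation col_size :: "nat \<Rightarrow> nat" where "col_size \<equiv> cs k D"
abbreviation hook :: "nat \<Rightarrow> nat \<Rightarrow> nat" where "hook x y \<equiv> hook_length D (x, y)"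

lemmas diag = kshapesD(1)[OF shape]
lemmas row_size_anti = kshapesD(2)[OF shape]
lemmas col_size_anti = kshapesD(3)[OF shape]
lemmas rw_anti = row_count_mono[OF diag]
lemmas ht_anti = col_count_mono[OF diag]
lemmas rw_iff_ht = row_le_iff_col_le[OF diag]
lemmas mem_rw = mem_diagram_row[OF diag]
lemmas mem_ht = mem_diagram_col[OF diag]
lemmas hook_add = hook_length_add[OF diag]
lemmas hook_rs = hook_le_iff_rs[OF diag, where k = k]
lemmas hook_cs = hook_le_iff_cs[OF diag, where k = k]
lemmas col_size_le = cs_le_col_count[OF diag, where k = k]

lemma col_size_pos: "1 \<le> y \<Longrightarrow> y \<le> rw 1 \<Longrightarrow> 1 \<le> col_size y"
  using cs_pos[OF shape] k_ge_2 by simp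

end

section \<open>Every hook of length \<open>k\<close> starts a move, up to transposition\<close>

text \<open>The columns \<open>c\<close> to \<open>c + M - 1\<close>, up to the end of their block, are
  to lose a boundary cell. Their size is required to be at least two because they may reach to the end of
  row \<open>r\<close> and be followed by a gaining column: the row of \<open>k\<close> cells, all of whose
  columns have size one, has no row move.\<close>

locale move_source = kshape +
  fixes r c M :: nat
  assumes corner: "(r, c) \<in> D" "hook r c = k" "2 \<le> col_size c"
    and rightmost: "\<And>x y. (x, y) \<in> D \<Longrightarrow> c < y \<Longrightarrow> hook x y = k \<Longrightarrow> 2 \<le> col_size y \<Longrightarrow> False"
    and block: "\<And>j. j < M \<Longrightarrow> col_size (c + j) = col_size c"
    and block_end: "col_size (c + M) < col_size c"
begin

lemma corner_pos: "1 \<le> r" "1 \<le> c" "c \<le> rw r" "r \<le> ht c"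
  using corner(1) mem_rw mem_ht by auto

lemma ht_corner: "ht c + 1 = col_size c + r"
  using hook_eq_cs[OF diag corner(1,2)] .

lemma rw_corner: "rw r + 1 = row_size r + c"
  using hook_eq_rs[OF diag corner(1,2)] .

lemma k_corner: "k + r + c = rw r + ht c + 1"
  using hook_add[OF corner(1)] corner(2) by simp

lemma M_pos: "1 \<le> M" using block_end by (cases M) auto

text \<open>If a column of the block were shorter than its predecessor, then its boundary would begin in
  a lower row \<open>x\<close>. The row sizes make row \<open>x\<close> so long that the first boundary
  cell of this column has hook length \<open>k\<close>, contrary to the choice of \<open>c\<close>.\<close>

lemma block_heights:
  assumes "j < M" shows "ht (c + j) = ht c"
  using assms
proof (induction j)
  case (Suc j)
  let ?y = "c + Suc j"
  have IH: "ht (c + j) = ht c" using Suc by simp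
  have S: "col_size ?y = col_size c" by (rule block[OF Suc.prems])
  have Sj: "col_size (c + j) = col_size c" using block Suc.prems by simp
  show ?case
  proof (rule ccontr)
    assume "ht ?y \<noteq> ht c"
    then have lt: "ht ?y < ht c" using ht_anti[OF corner_pos(2), of ?y] by simp
    define x where "x = ht ?y + 1 - col_size c"
    have x: "1 \<le> x" "x + col_size c = ht ?y + 1" using col_size_le[of ?y] S unfolding x_def by simp_all
    have xr: "x < r" using x ht_corner lt by simp
    have mem: "(x, ?y) \<in> D" using mem_ht x corner(3) by simp
    have mem': "(x, c + j) \<in> D" using mem_rw mem corner_pos by simp
    have "hook x ?y \<le> k" using hook_cs[OF mem] x S by simp
    moreover have "\<not> hook x (c + j) \<le> k" using hook_cs[OF mem'] Sj IH x lt by simp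
    moreover have "row_size r \<le> row_size x" using row_size_anti[OF x(1)] xr by simp
    ultimately have "k \<le> hook x ?y" using hook_rs[OF mem'] hook_add[OF mem] x rw_corner k_corner ht_corner by simp
    then show False using rightmost[OF mem] \<open>hook x ?y \<le> k\<close> S corner(3) by simp
  qed
qed simp

lemma block_end_le: "c + M \<le> rw r + 1"
proof -
  obtain m where Mm: "M = Suc m" using M_pos by (cases M) auto
  then show ?thesis using rw_iff_ht[of r "c + m"] block_heights[of m] corner_pos by simp
qed

definition addable_row :: "nat \<Rightarrow> bool" where
  "addable_row p \<longleftrightarrow> 1 \<le> p \<and> p \<le> r \<and> (1 < p \<longrightarrow> rw p + M \<le> rw (p - 1)) \<and> (p = r \<or> rw r < rw p)"

definition final_row :: "nat \<Rightarrow> bool" where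
  "final_row p \<longleftrightarrow> (\<forall>j<M. col_size (rw p + Suc j) = col_size (rw p + 1)) \<and>
    (\<forall>n<M. \<forall>x. (x, rw p + Suc n) \<in> D \<longrightarrow> hook x (rw p + Suc n) \<noteq> k) \<and>
    col_size (rw p + 1) + of_bool (rw p < c + M) < col_size (rw p)"

definition next_row :: "nat \<Rightarrow> nat \<Rightarrow> bool" where
  "next_row p q \<longleftrightarrow> k \<le> hook q (rw p + 1) + 1 \<and> hook q (rw p + 1) \<le> k \<and> k < hook q (rw p) \<and>
    (1 < q \<longrightarrow> k < hook (q - 1) (rw p + M))"

text \<open>Row \<open>r - 1\<close> is outside the boundary as far as the last column of the block, and
  its row size is at least that of row \<open>r\<close>; so its length exceeds that of row \<open>r\<close>
  by \<open>M\<close> or more.\<close>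

lemma addable_row_start: "addable_row r"
proof -
  obtain m where Mm: "M = Suc m" using M_pos by (cases M) auto
  have "rw r + M \<le> rw (r - 1)" if "1 < r"
  proof -
    let ?y = "c + m"
    have Hy: "ht ?y = ht c" "col_size ?y = col_size c" using block_heights[of m] block[of m] Mm by auto
    have mem: "(r - 1, ?y) \<in> D" unfolding mem_ht Hy using that corner_pos by auto
    have "\<not> hook (r - 1) ?y \<le> k" unfolding hook_cs[OF mem] Hy using ht_corner that by linarith
    moreover have "row_size r \<le> row_size (r - 1)" using row_size_anti that by simp
    ultimately show ?thesis using hook_rs[OF mem] rw_corner Mm by simp
  qed
  then show ?thesis unfolding addable_row_def using corner_pos by simp
qed

text \<open>Let \<open>L\<close> be the length of row \<open>p\<close>. If \<open>p = 1\<close>, the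
  columns to the right are empty and the gain is legal. Otherwise the columns \<open>L + 1, \<dots>, L +
  M\<close>, whose top cells lie in row \<open>p - 1\<close>, have weakly decreasing sizes and boundaries
  that begin weakly lower from left to right; so their boundaries all begin in one row \<open>q\<close>. If
  the hook at \<open>(q, L + 1)\<close> is shorter than \<open>k\<close> and the gain is legal, row
  \<open>p\<close> is the last one. If the gain is not legal, column \<open>L\<close>, after its loss if it
  has one, is no larger than column \<open>L + 1\<close>. It is taller, so its boundary begins above row
  \<open>q\<close>, and this forces the hook at \<open>(q, L + 1)\<close> to have length at least \<open>k
  - 1\<close>.\<close>

lemma final_or_next_row:
  assumes "addable_row p"
  shows "final_row p \<or> (\<exists>q<p. addable_row q \<and> next_row p q)"
proof -
  obtain m where Mm: "M = Suc m" using M_pos by (cases M) auto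
  define L where "L = rw p"
  have p: "1 \<le> p" "p \<le> r" "1 < p \<Longrightarrow> L + M \<le> rw (p - 1)" "p = r \<or> rw r < L"
    using assms unfolding addable_row_def L_def by auto
  have L: "rw r \<le> L" "1 \<le> L" "c + M \<le> L + 1" using rw_anti[OF p(1,2)] corner_pos block_end_le unfolding L_def by simp_all
  have LR: "L \<le> rw 1" using rw_anti[of 1 p] p unfolding L_def by simp
  have last: "L + 1 = c + M \<and> p = r" if "L < c + M" using that L p(4) block_end_le by auto
  show ?thesis
  proof (cases "p = 1")
    case True
    have no: "\<not> 1 \<le> ht (L + Suc j)" for j using rw_iff_ht[of 1 "L + Suc j"] True unfolding L_def by simp
    then have zero: "col_size (L + Suc j) = 0" for j using col_size_le[of "L + Suc j"] by (metis le_zero_eq not_less_eq_eq One_nat_def)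
    have "of_bool (L < c + M) < col_size L"
    proof (cases "L < c + M")
      case True
      then have "L = c + m" using last Mm by simp
      then show ?thesis using block[of m] Mm corner(3) True by simp
    next
      case False
      then show ?thesis using col_size_pos[OF L(2) LR] by simp
    qed
    then have "final_row p" unfolding final_row_def L_def[symmetric] using zero[of 0] zero no mem_ht
      by (metis One_nat_def add.left_neutral add_Suc_right add_0_right le_trans)
    then show ?thesis ..
  next
    case False
    then have p1: "1 < p" "1 \<le> p - 1" using p by auto
    have wide: "L + M \<le> rw (p - 1)" using p(3) p1(1) .
    have HL: "ht (L + j) = p - 1" if "1 \<le> j" "j \<le> M" for j
    proof -
      have "p - 1 \<le> ht (L + j)" using rw_iff_ht[of "p - 1" "L + j"] wide that p1 by simp
      moreover have "\<not> p \<le> ht (L + j)" using rw_iff_ht[of p "L + j"] that p1 unfolding L_def by simp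
      ultimately show ?thesis by simp
    qed
    have H1: "ht (L + 1) = p - 1" using HL[of 1] M_pos by simp
    have LR1: "L + 1 \<le> rw 1" using rw_anti[OF _ p1(2)] wide M_pos by force
    have f1: "1 \<le> col_size (L + 1)" using col_size_pos LR1 by simp
    \<comment> \<open>The row in which the boundary of column \<open>L + 1\<close> begins.\<close>
    define q where "q = p - col_size (L + 1)"
    have q: "1 \<le> q" "q < p" "q + col_size (L + 1) = p" using col_size_le[of "L + 1"] H1 f1 p1 unfolding q_def by auto
    have mem: "(q, L + 1) \<in> D" using mem_ht H1 q by simp
    have le: "hook q (L + 1) \<le> k" using hook_cs[OF mem] H1 q by simp
    have hq: "hook q (L + 1) + q + L + 1 = rw q + p" using hook_add[OF mem] H1 p1 by simp
    have memL: "(q, L) \<in> D" using mem mem_rw L by simp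
    have qp: "q \<le> p - 1" using q by linarith
    have widq: "L + M \<le> rw q" using wide rw_anti[OF q(1) qp] by linarith
    have below: "(q - 1, L + M) \<in> D" "k < hook (q - 1) (L + M)" if "1 < q"
    proof -
      show m: "(q - 1, L + M) \<in> D" unfolding mem_ht using HL[of M] M_pos that q by auto
      have "col_size (L + M) \<le> col_size (L + 1)" using col_size_anti M_pos by simp
      then have "\<not> hook (q - 1) (L + M) \<le> k" unfolding hook_cs[OF m] HL[OF M_pos order_refl] using q that by linarith
      then show "k < hook (q - 1) (L + M)" by simp
    qed
    have f_eq: "col_size (L + Suc j) = col_size (L + 1)" if "j < M" for j
    proof -
      have m: "(q, L + Suc j) \<in> D" using mem_ht HL[of "Suc j"] that q by simp
      then have "hook q (L + Suc j) \<le> k"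
        using hook_length_left[OF diag m, of "L + 1"] le by simp
      then have "col_size (L + 1) \<le> col_size (L + Suc j)" using hook_cs[OF m] HL[of "Suc j"] that q by auto
      moreover have "col_size (L + Suc j) \<le> col_size (L + 1)" using col_size_anti by simp
      ultimately show ?thesis by simp
    qed
    show ?thesis
    proof (cases "hook q (L + 1) = k \<or> \<not> col_size (L + 1) + of_bool (L < c + M) < col_size L")
      case True
      have good: "addable_row q"
      proof -
        have "rw q + M \<le> rw (q - 1)" if "1 < q"
        proof -
          have "row_size q \<le> row_size (q - 1)" using row_size_anti that by simp
          then show ?thesis using hook_rs[OF mem] le hook_rs[OF below(1)[OF that]] below(2)[OF that] by simp
        qed
        then show ?thesis unfolding addable_row_def using q p widq L M_pos by simp
      qed
      have "k \<le> hook q (L + 1) + 1 \<and> k < hook q L"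
      proof (cases "hook q (L + 1) = k")
        case True
        have "hook q (L + 1) + (L + 1) \<le> hook q L + L"
          using hook_length_left[OF diag mem, of L] L by simp
        then show ?thesis using True by simp
      next
        case False
        then have ineq: "col_size L \<le> col_size (L + 1) + of_bool (L < c + M)" using True by simp
        show ?thesis
        proof (cases "L < c + M")
          case True
          \<comment> \<open>Column \<open>L\<close> ends the losing block and is about to shrink itself,
            so the bound is derived from the size of row \<open>q\<close>, which is at least that of row \<open>r\<close>.\<close>
          then have Lr: "L + 1 = c + M" "p = r" using last by auto
          have "L = c + m" using Lr Mm by simp
          then have "ht L = ht c" "col_size L = col_size c" using block_heights[of m] block[of m] Mm by auto
          moreover have "col_size (L + 1) < col_size c" using block_end Lr by simp
          ultimately have fc: "col_size c = col_size (L + 1) + 1" "ht L = ht c" "col_size L = col_size c" using ineq True by auto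
          have "\<not> hook q L \<le> k" using hook_cs[OF memL] fc ht_corner Lr q by simp
          moreover have "row_size r \<le> row_size q" using row_size_anti q Lr by simp
          ultimately have "rw r + 1 + L \<le> rw q + c" using hook_rs[OF memL] rw_corner by simp
          then have "k \<le> hook q (L + 1) + 1" using hq k_corner ht_corner fc q Lr by simp
          then show ?thesis using \<open>\<not> hook q L \<le> k\<close> by simp
        next
          case False
          then have fL: "col_size L = col_size (L + 1)" using ineq col_size_anti[of L "L + 1"] L by simp
          have HL': "p \<le> ht L" using rw_iff_ht[of p L] p L unfolding L_def by simp
          \<comment> \<open>The cell just below the boundary in column \<open>L\<close>; its row is no longer than row \<open>q\<close>.\<close>
          define x where "x = ht L - col_size L"
          have x: "x + col_size L = ht L" "q \<le> x" using col_size_le[of L] HL' q fL unfolding x_def by auto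
          have memx: "(x, L) \<in> D" using mem_ht x q L by simp
          have "\<not> hook x L \<le> k" using hook_cs[OF memx] x by simp
          moreover have "rw x \<le> rw q" using rw_anti q x by simp
          ultimately have "k \<le> hook q (L + 1) + 1" using hook_add[OF memx] hq x q fL by simp
          moreover have "\<not> hook q L \<le> k" using hook_cs[OF memL] HL' q fL by simp
          ultimately show ?thesis by simp
        qed
      qed
      then have "next_row p q" unfolding next_row_def L_def[symmetric] using le below(2) by simp
      then show ?thesis using good q by blast
    next
      case False
      have "hook x (L + Suc n) \<noteq> k" if n: "n < M" and m: "(x, L + Suc n) \<in> D" for x n
      proof (cases "x < q")
        case True
        have "1 \<le> x" using m mem_rw by simp
        then have b: "1 < q" using True by simp
        have m1: "(q - 1, L + Suc n) \<in> D" using mem_rw below(1)[OF b] n by simp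
        have "hook (q - 1) (L + M) + (L + M) \<le> hook (q - 1) (L + Suc n) + (L + Suc n)"
          using hook_length_left[OF diag below(1)[OF b], of "L + Suc n"] n by simp
        moreover have "hook (q - 1) (L + Suc n) + (q - 1) \<le> hook x (L + Suc n) + x"
          using hook_length_below[OF diag m1 \<open>1 \<le> x\<close>] True by simp
        ultimately show ?thesis using below(2)[OF b] True n by linarith
      next
        case ge: False
        have m1: "(x, L + 1) \<in> D" using mem_rw m by simp
        have "hook x (L + Suc n) + (L + Suc n) \<le> hook x (L + 1) + (L + 1)"
          using hook_length_left[OF diag m, of "L + 1"] by simp
        moreover have "hook x (L + 1) + x \<le> hook q (L + 1) + q"
          using hook_length_below[OF diag m1, of q] ge q by simp
        ultimately show ?thesis using False le ge by linarith
      qed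
      then have "final_row p" unfolding final_row_def L_def[symmetric] using f_eq False by simp
      then show ?thesis ..
    qed
  qed
qed

lemma row_move_from_corner: "\<exists>l E. row_move k M l D E \<and> rs k D = rs k E"
proof -
  obtain ps where ps: "ps \<noteq> []" "hd ps = r" "sorted_wrt (>) ps" "\<And>q. q \<in> set ps \<Longrightarrow> addable_row q"
    "\<And>i. Suc i < length ps \<Longrightarrow> next_row (ps ! i) (ps ! Suc i)" "final_row (last ps)"
    using descending_chain[of addable_row final_row next_row r] final_or_next_row addable_row_start by blast
  interpret S: strips k M c D ps
  proof
    show "1 \<le> p" if "p \<in> set ps" for p using ps(4)[OF that] unfolding addable_row_def by simp
    show "rw p + M \<le> rw (p - 1)" if "p \<in> set ps" "1 < p" for p
      using ps(4)[OF that(1)] that(2) unfolding addable_row_def by simp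
    show "(hd ps, c) \<in> D" "hook (hd ps) c = k" using corner ps(2) by simp_all
  next
    fix i assume "Suc i < length ps"
    from ps(5)[OF this]
    show "k \<le> hook (ps ! Suc i) (rw (ps ! i) + 1) + 1"
      "hook (ps ! Suc i) (rw (ps ! i) + 1) \<le> k" "k < hook (ps ! Suc i) (rw (ps ! i))"
      "1 < ps ! Suc i \<Longrightarrow> k < hook (ps ! Suc i - 1) (rw (ps ! i) + M)"
      unfolding next_row_def by auto
  next
    show "hook x (rw (last ps) + Suc n) \<noteq> k"
      if "n < M" "(x, rw (last ps) + Suc n) \<in> D" for x n
      using ps(6) that unfolding final_row_def by blast
  qed (use diag ps block_heights in blast)+

  define L where "L = rw (last ps)"
  have stop: "\<And>j. j < M \<Longrightarrow> col_size (L + Suc j) = col_size (L + 1)"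
    "col_size (L + 1) + of_bool (L < c + M) < col_size L"
    using ps(6) unfolding final_row_def L_def by auto
  have LM: "c + M \<le> L + 1" using block_end_le S.rw_hd_le_last ps(2) unfolding L_def by simp
  define e where "e = cs k (S.filled M)"
  have cs: "e y + of_bool (c \<le> y \<and> y < c + M) = col_size y + of_bool (L < y \<and> y \<le> L + M)" for y
    using S.cs_filled[of M y] unfolding L_def e_def by simp
  have "e (Suc i) \<le> e i" if "1 \<le> i" for i
  proof -
    obtain m where Mm: "M = Suc m" using M_pos by (cases M) auto
    have anti: "col_size (Suc i) \<le> col_size i" using col_size_anti[OF that] by simp
    have "col_size (Suc i) < col_size i" if "c \<le> i" "Suc i = c + M"
    proof -
      have "i = c + m" using that Mm by simp
      then have "col_size i = col_size c" using block[of m] Mm by simp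
      then show ?thesis using block_end that by simp
    qed
    moreover have "col_size (Suc i) + of_bool (L < c + M) < col_size i" if "i = L" using stop(2) that by simp
    ultimately show ?thesis
      using cs[of i] cs[of "Suc i"] anti LM M_pos
      by (cases "i = L"; cases "Suc i = c + M") (auto simp: of_bool_def split: if_splits)
  qed
  then have "is_partition (cs k (S.filled M))"
    using finite_support_cs[OF S.is_diagram_filled[of M]] unfolding is_partition_def e_def by simp
  moreover have "is_partition (rs k (S.filled M))"
    using shape S.rs_filled[of M] unfolding kshapes_def by simp
  ultimately have "S.filled M \<in> kshapes k"
    using S.is_diagram_filled[of M] unfolding kshapes_def by simp
  then have "row_move k M (length ps) D (S.filled M)"
    using S.row_move_filled[OF shape] block stop(1) unfolding L_def by blast
  moreover have "rs k D = rs k (S.filled M)" using S.rs_filled[of M] by simp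
  ultimately show ?thesis by blast
qed

end

lemma row_move_from:
  assumes D: "D \<in> kshapes k" and k: "2 \<le> k"
    and hook: "(r', c') \<in> D" "hook_length D (r', c') = k" "2 \<le> cs k D c'"
  shows "\<exists>M\<ge>1. \<exists>l E. row_move k M l D E \<and> rs k D = rs k E"
proof -
  interpret kshape k D using D k by unfold_locales
  define K where "K = {c. \<exists>x. (x, c) \<in> D \<and> hook x c = k \<and> 2 \<le> col_size c}"
  have "K \<subseteq> snd ` D" unfolding K_def by force
  then have finK: "finite K" using finite_diagram[OF diag] finite_surj by blast
  have "c' \<in> K" using hook unfolding K_def by blast
  define c where "c = Max K"
  have "c \<in> K" using Max_in[OF finK] \<open>c' \<in> K\<close> unfolding c_def by blast
  then obtain r where rc: "(r, c) \<in> D" "hook r c = k" "2 \<le> col_size c" unfolding K_def by blast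
  have max: False if "(x, y) \<in> D" "c < y" "hook x y = k" "2 \<le> col_size y" for x y
  proof -
    have "y \<in> K" using that unfolding K_def by blast
    then show False using Max_ge[OF finK] that(2) unfolding c_def by (meson not_less)
  qed
  have c1: "1 \<le> c" using rc(1) mem_rw by auto
  define M where "M = (LEAST j. col_size (c + j) < col_size c)"
  have "\<not> 1 \<le> ht (c + (rw 1 + 1))" using rw_iff_ht[of 1 "c + (rw 1 + 1)"] by simp
  then have "col_size (c + (rw 1 + 1)) < col_size c" using rc(3) col_size_le[of "c + (rw 1 + 1)"] by simp
  then have block_end: "col_size (c + M) < col_size c" unfolding M_def by (rule LeastI)
  have block: "col_size (c + j) = col_size c" if "j < M" for j
    using not_less_Least[of j "\<lambda>j. col_size (c + j) < col_size c"] that col_size_anti[OF c1, of "c + j"]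
    unfolding M_def by simp
  interpret move_source k D r c M
    using rc max block block_end by unfold_locales
  show ?thesis using row_move_from_corner M_pos by blast
qed

section \<open>Every hook of length \<open>k + 1\<close> ends a move\<close>

text \<open>The mirror image of the locale \<open>move_source\<close>: the columns \<open>b\<close> to
  \<open>b + m\<close>, from the start of their block to the column of the corner, are those that have lost
  a boundary cell and get it back, and cells are removed instead of added.\<close>

locale move_target = kshape k E for k :: nat and E :: diagram +
  fixes r b m :: nat
  assumes corner: "(r, b + m) \<in> E" "hook r (b + m) = k + 1"
    and leftmost: "\<And>x y. (x, y) \<in> E \<Longrightarrow> y < b + m \<Longrightarrow> hook x y \<noteq> k + 1"
    and b_pos: "1 \<le> b"
    and block: "\<And>y. b \<le> y \<Longrightarrow> y \<le> b + m \<Longrightarrow> col_size y = col_size (b + m)"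
    and block_start: "b = 1 \<or> col_size (b + m) < col_size (b - 1)"
begin

abbreviation M :: nat where "M \<equiv> Suc m"

lemma corner_pos: "1 \<le> r" "r \<le> ht (b + m)" "b + m \<le> rw r"
  using corner(1) mem_rw mem_ht by auto

text \<open>The cells above and to the right of the corner exist, since no nonempty row or column has
  size zero, and they are the first boundary cells of its column and of its row.\<close>

lemma ht_corner: "ht (b + m) = col_size (b + m) + r" "r < ht (b + m)"
proof -
  have "b + m \<le> rw 1" using rw_anti[of 1 r] corner_pos by simp
  then have pos: "1 \<le> col_size (b + m)" using col_size_pos b_pos by simp
  have ge: "col_size (b + m) + r \<le> ht (b + m)" using hook_cs[OF corner(1)] corner(2) by simp
  then have mem: "(r + 1, b + m) \<in> E" using mem_ht pos b_pos by simp
  have "hook (r + 1) (b + m) \<le> k" using hook_length_below[OF diag mem, of r] corner(2) corner_pos by simp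
  then show "ht (b + m) = col_size (b + m) + r" using hook_cs[OF mem] ge by simp
  then show "r < ht (b + m)" using pos by simp
qed

lemma rw_corner: "rw r = row_size r + (b + m)"
proof -
  have "r \<le> ht 1" using ht_anti[of 1 "b + m"] corner_pos b_pos by simp
  then have pos: "1 \<le> row_size r"
    using cs_pos[of "E\<inverse>" k r] shape k_ge_2 corner_pos by (simp add: cs_converse row_count_converse)
  have ge: "row_size r + (b + m) \<le> rw r" using hook_rs[OF corner(1)] corner(2) by simp
  then have mem: "(r, b + m + 1) \<in> E" using mem_rw pos corner_pos by simp
  have "hook r (b + m + 1) \<le> k" using hook_length_left[OF diag mem, of "b + m"] corner(2) b_pos by simp
  then show ?thesis using hook_rs[OF mem] ge by simp
qed

lemma k_corner: "k = row_size r + col_size (b + m)"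
  using hook_add[OF corner(1)] corner(2) ht_corner rw_corner by simp

text \<open>If a column of the block were taller than its successor, then its boundary would begin in a
  higher row. The row just below that beginning has at most the size of row \<open>r\<close>, which bounds
  the hook there by \<open>k + 1\<close>; being outside the boundary it has exactly that length, contrary
  to the choice of the leftmost corner.\<close>

lemma block_heights:
  assumes "b \<le> y" "y \<le> b + m"
  shows "ht y = ht (b + m)"
  using assms(2,1)
proof (induction rule: inc_induct)
  case (step y)
  have IH: "ht (Suc y) = ht (b + m)" using step by simp
  have S: "col_size y = col_size (b + m)" "col_size (Suc y) = col_size (b + m)"
    using block[of y] block[of "Suc y"] step by simp_all
  have y1: "1 \<le> y" using b_pos step by simp
  show ?case
  proof (rule ccontr)
    assume "ht y \<noteq> ht (b + m)"
    then have gt: "ht (b + m) < ht y" using ht_anti[OF y1, of "Suc y"] IH by simp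
    define x where "x = ht y - col_size (b + m)"
    have x: "x + col_size (b + m) = ht y" "r < x" using gt ht_corner unfolding x_def by simp_all
    have mem: "(x, y) \<in> E" using mem_ht x y1 by simp
    have hk: "\<not> hook x y \<le> k" using hook_cs[OF mem] x S by simp
    have ge: "y \<le> rw x" using mem mem_rw by simp
    have "rw x \<le> row_size x + y"
    proof (cases "rw x = y")
      case False
      then have mem': "(x, Suc y) \<in> E" using mem_rw x ge by simp
      then have "hook x (Suc y) \<le> k" using hook_cs[OF mem'] S IH x ht_corner by simp
      then show ?thesis using hook_rs[OF mem'] by simp
    qed simp
    moreover have "row_size x \<le> row_size r" using row_size_anti corner_pos x by simp
    ultimately have "hook x y \<le> k + 1" using hook_add[OF mem] x k_corner by simp
    then show False using leftmost[OF mem] hk step by simp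
  qed
qed simp

definition removable_row :: "nat \<Rightarrow> bool" where
  "removable_row p \<longleftrightarrow> 1 \<le> p \<and> p \<le> r \<and> rw (p + 1) + M \<le> rw p"

definition final_row :: "nat \<Rightarrow> bool" where
  "final_row p \<longleftrightarrow> (\<forall>j\<le>m. col_size (rw p - j) = col_size (rw p)) \<and>
    (\<forall>j\<le>m. \<forall>x<p. (x, rw p - j) \<in> E \<longrightarrow> hook x (rw p - j) \<noteq> k + 1) \<and>
    col_size (rw p + 1) < col_size (rw p)"

definition next_row :: "nat \<Rightarrow> nat \<Rightarrow> bool" where
  "next_row p q \<longleftrightarrow> q < p \<and> k + 1 \<le> hook q (rw p) \<and> hook q (rw p) \<le> k + 2"

lemma removable_row_start: "removable_row r"
proof -
  have mem: "(r + 1, b) \<in> E" using mem_ht block_heights[of b] ht_corner b_pos by simp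
  have "hook (r + 1) b \<le> k" using hook_cs[OF mem] block[of b] block_heights[of b] ht_corner by simp
  moreover have "row_size (r + 1) \<le> row_size r" using row_size_anti corner_pos by simp
  ultimately have "rw (r + 1) + M \<le> rw r" using hook_rs[OF mem] rw_corner by simp
  then show ?thesis unfolding removable_row_def using corner_pos by simp
qed

text \<open>The last \<open>M\<close> columns of row \<open>p\<close>, ending with column
  \<open>L\<close>, have row \<open>p\<close> as their top row and, as for the construction of a target,
  boundaries that begin in the same row \<open>q + 1\<close>. If the hook at \<open>(q, L)\<close> has
  length \<open>k + 1\<close>, it returns to the boundary when row \<open>p\<close> is shortened, so row
  \<open>q\<close> has to be shortened too. If column \<open>L + 1\<close> is as large as column
  \<open>L\<close>, then column \<open>L\<close> must not shrink; comparing hooks in the two columns shows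
  that the hook at \<open>(q, L)\<close> has length at most \<open>k + 2\<close>, and shortening row
  \<open>q\<close> as well brings that cell back.\<close>

lemma final_or_next_row:
  assumes "removable_row p"
  shows "final_row p \<or> (\<exists>q<p. removable_row q \<and> next_row p q)"
proof -
  define L where "L = rw p"
  have p: "1 \<le> p" "p \<le> r" "rw (p + 1) + M \<le> L" using assms unfolding removable_row_def L_def by auto
  have L1: "1 \<le> L" "m < L" using p by auto
  have LR: "L \<le> rw 1" using rw_anti[of 1 p] p unfolding L_def by simp
  have HL: "ht (L - j) = p" if "j \<le> m" for j
  proof -
    have j1: "1 \<le> L - j" using that L1 by simp
    have "p \<le> ht (L - j)" using rw_iff_ht[OF p(1) j1] unfolding L_def by simp
    moreover have "\<not> p + 1 \<le> ht (L - j)" using rw_iff_ht[OF _ j1, of "p + 1"] p that by auto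
    ultimately show ?thesis by simp
  qed
  have H0: "ht L = p" using HL[of 0] by simp
  have f1: "1 \<le> col_size L" using col_size_pos L1 LR by simp
  define q where "q = p - col_size L"
  have q: "q < p" "q + col_size L = p" using col_size_le[of L] H0 f1 p unfolding q_def by auto
  have mem: "(q, L) \<in> E" "\<not> hook q L \<le> k" "hook q L + q + L = rw q + p + 1" if "1 \<le> q"
  proof -
    show m: "(q, L) \<in> E" using mem_ht H0 that q L1 by simp
    show "\<not> hook q L \<le> k" using hook_cs[OF m] H0 q by simp
    show "hook q L + q + L = rw q + p + 1" using hook_add[OF m] H0 by simp
  qed
  have left: "(q, L - j) \<in> E" "hook q L + j \<le> hook q (L - j)" if "1 \<le> q" "j \<le> m" for j
  proof -
    have j1: "1 \<le> L - j" using that L1 by simp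
    show "(q, L - j) \<in> E" using mem_ht j1 HL[OF that(2)] that(1) q by simp
    show "hook q L + j \<le> hook q (L - j)"
      using hook_length_left[OF diag mem(1)[OF that(1)] j1] that L1 by simp
  qed
  have f_eq: "col_size (L - j) = col_size L" if "j \<le> m" for j
  proof -
    have "col_size L \<le> col_size (L - j)" using col_size_anti[of "L - j" L] that L1 by simp
    moreover have "col_size (L - j) \<le> col_size L"
    proof (cases "q = 0")
      case True
      then show ?thesis using col_size_le[of "L - j"] HL[OF that] q by simp
    next
      case False
      then have q1: "1 \<le> q" by simp
      have "\<not> hook q (L - j) \<le> k" using left(2)[OF q1 that] mem(2)[OF q1] by simp
      then show ?thesis using hook_cs[OF left(1)[OF q1 that]] HL[OF that] q by simp
    qed
    ultimately show ?thesis by simp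
  qed
  show ?thesis
  proof (cases "1 \<le> q \<and> (hook q L = k + 1 \<or> col_size L \<le> col_size (L + 1))")
    case True
    then have q1: "1 \<le> q" by simp
    have "hook q L \<le> k + 2"
    proof (cases "hook q L = k + 1")
      case False
      then have fL: "col_size (L + 1) = col_size L" using True col_size_anti[OF L1(1), of "L + 1"] by simp
      have Hlt: "ht (L + 1) < p" using rw_iff_ht[OF p(1), of "L + 1"] unfolding L_def by simp
      \<comment> \<open>The bottom boundary cell of column \<open>L + 1\<close> has a hook at most
        two shorter than the hook at \<open>(q, L)\<close>.\<close>
      define x where "x = ht (L + 1) + 1 - col_size L"
      have x: "1 \<le> x" "x \<le> q" "x + col_size L = ht (L + 1) + 1"
        using col_size_le[of "L + 1"] fL Hlt q unfolding x_def by auto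
      have memx: "(x, L + 1) \<in> E" using mem_ht x f1 by simp
      have "hook x (L + 1) \<le> k" using hook_cs[OF memx] fL x by simp
      moreover have "rw q \<le> rw x" using rw_anti x by simp
      ultimately show ?thesis using hook_add[OF memx] mem(3)[OF q1] x q by simp
    qed simp
    then have "next_row p q" unfolding next_row_def L_def[symmetric] using mem(2)[OF q1] q by simp
    moreover have "removable_row q"
    proof -
      have j1: "1 \<le> L - m" using L1 by simp
      have mem': "(q + 1, L - m) \<in> E" using mem_ht j1 HL[of m] q by simp
      have "hook (q + 1) (L - m) \<le> k" using hook_cs[OF mem'] HL[of m] f_eq[of m] q by simp
      moreover have "row_size (q + 1) \<le> row_size q" using row_size_anti q1 by simp
      ultimately have "rw (q + 1) + M \<le> rw q"
        using hook_rs[OF mem'] hook_rs[OF mem(1)[OF q1]] mem(2)[OF q1] L1 by simp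
      then show ?thesis unfolding removable_row_def using q1 q p by simp
    qed
    ultimately show ?thesis using q by blast
  next
    case False
    have "col_size (L + 1) < col_size L"
    proof (cases "q = 0")
      case True
      have "\<not> p \<le> ht (L + 1)" using rw_iff_ht[OF p(1), of "L + 1"] unfolding L_def by simp
      then show ?thesis using col_size_le[of "L + 1"] True q by simp
    qed (use False in simp)
    moreover have "hook x (L - j) \<noteq> k + 1" if j: "j \<le> m" and x: "x < p" "(x, L - j) \<in> E" for x j
    proof (cases "x \<le> q")
      case True
      have x1: "1 \<le> x" using x mem_rw by simp
      then have q1: "1 \<le> q" using True by simp
      have "hook q (L - j) \<le> hook x (L - j)"
        using hook_length_below[OF diag left(1)[OF q1 j] x1 True] True by simp
      moreover have "k + 1 < hook q L" using False q1 mem(2)[OF q1] by simp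
      ultimately show ?thesis using left(2)[OF q1 j] by simp
    next
      case gt: False
      then have "hook x (L - j) \<le> k" using hook_cs[OF x(2)] HL[OF j] f_eq[OF j] q by simp
      then show ?thesis by simp
    qed
    ultimately have "final_row p" unfolding final_row_def L_def[symmetric] using f_eq by simp
    then show ?thesis ..
  qed
qed

definition trimmed :: "nat set \<Rightarrow> diagram" where
  "trimmed P = {(x, y) \<in> E. x \<in> P \<longrightarrow> y + M \<le> rw x}"

lemma mem_trimmed:
  "(x, y) \<in> trimmed P \<longleftrightarrow> 1 \<le> x \<and> 1 \<le> y \<and> y + (if x \<in> P then M else 0) \<le> rw x"
  unfolding trimmed_def using mem_rw[of x y] by auto

context
  fixes P :: "nat set"
  assumes P: "\<And>p. p \<in> P \<Longrightarrow> removable_row p"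
begin

lemma long_above: "p \<in> P \<Longrightarrow> p < x \<Longrightarrow> rw x + M \<le> rw p"
  using P[of p] rw_anti[of "p + 1" x] unfolding removable_row_def by simp

lemma is_diagram_trimmed: "is_diagram (trimmed P)"
proof (rule is_diagramI)
  show "finite (trimmed P)"
    by (rule finite_subset[OF _ finite_diagram[OF diag]]) (auto simp: trimmed_def)
  show "1 \<le> x \<and> 1 \<le> y" if "(x, y) \<in> trimmed P" for x y using that mem_trimmed by simp
  fix x y x' y'
  assume a: "(x, y) \<in> trimmed P" "1 \<le> x'" "x' \<le> x" "1 \<le> y'" "y' \<le> y"
  have y: "y + (if x \<in> P then M else 0) \<le> rw x" using a(1) mem_trimmed by simp
  have "y' + (if x' \<in> P then M else 0) \<le> rw x'"
  proof (cases "x' \<in> P \<and> x' < x")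
    case True
    then show ?thesis using long_above[of x' x] y a(5) by (simp split: if_splits)
  next
    case False
    then show ?thesis using rw_anti[OF a(2,3)] y a(3,5) by (cases "x' = x") (auto split: if_splits)
  qed
  then show "(x', y') \<in> trimmed P" using mem_trimmed a by simp
qed

lemma row_count_trimmed:
  assumes "1 \<le> x"
  shows "row_count (trimmed P) x = rw x - (if x \<in> P then M else 0)"
proof -
  have "{j. (x, j) \<in> trimmed P} = {1..rw x - (if x \<in> P then M else 0)}"
    using mem_trimmed assms by auto
  then show ?thesis unfolding row_count_def[of "trimmed P"] by simp
qed

lemma col_count_trimmed_cut:
  assumes p: "p \<in> P" and y: "rw p < y + M" "y \<le> rw p" "1 \<le> y"
  shows "col_count (trimmed P) y = p - 1"
proof -
  have p1: "1 \<le> p" "rw (p + 1) + M \<le> rw p" using P[OF p] unfolding removable_row_def by auto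
  have mem: "(i, y) \<in> trimmed P \<longleftrightarrow> 1 \<le> i \<and> i < p" for i
  proof (cases "i < p")
    case True
    have "y + (if i \<in> P then M else 0) \<le> rw i" if "1 \<le> i"
      using long_above[of i p] rw_anti[OF that, of p] True y(2) by auto
    then show ?thesis using mem_trimmed True y(3) by auto
  next
    case False
    have "\<not> y + (if i \<in> P then M else 0) \<le> rw i"
      using long_above[OF p, of i] False p y by (cases "i = p") auto
    then show ?thesis using mem_trimmed False by simp
  qed
  have "{i. (i, y) \<in> trimmed P} = {1..<p}" unfolding mem by auto
  then show ?thesis unfolding col_count_def[of "trimmed P"] by simp
qed

lemma col_count_trimmed_uncut:
  assumes "\<And>p. p \<in> P \<Longrightarrow> y + M \<le> rw p"
  shows "col_count (trimmed P) y = ht y"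
proof -
  have "{i. (i, y) \<in> trimmed P} = {i. (i, y) \<in> E}" using assms unfolding trimmed_def by auto
  then show ?thesis unfolding col_count_def by simp
qed

end

lemma row_move_to_corner: "\<exists>l D. row_move k M l D E \<and> rs k D = rs k E"
proof -
  obtain ps where ps: "ps \<noteq> []" "hd ps = r" "sorted_wrt (>) ps" "\<And>q. q \<in> set ps \<Longrightarrow> removable_row q"
    "\<And>i. Suc i < length ps \<Longrightarrow> next_row (ps ! i) (ps ! Suc i)" "final_row (last ps)"
    using descending_chain[of removable_row final_row next_row r] final_or_next_row removable_row_start by blast
  define D where "D = trimmed (set ps)"
  have long: "rw x + M \<le> rw p" if "p \<in> set ps" "p < x" for p x
    using long_above[of "set ps"] ps(4) that by blast
  have diagD: "is_diagram D" unfolding D_def by (rule is_diagram_trimmed[OF ps(4)])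
  have rows: "row_count D x = rw x - (if x \<in> set ps then M else 0)" if "1 \<le> x" for x
    unfolding D_def by (rule row_count_trimmed[OF ps(4) that])
  have good: "1 \<le> p" "p \<le> r" "rw (p + 1) + M \<le> rw p" if "p \<in> set ps" for p
    using ps(4)[OF that] unfolding removable_row_def by auto
  have row_ps: "row_count D p + M = rw p" if "p \<in> set ps" for p
    using rows[OF good(1)[OF that]] good(3)[OF that] that by simp
  have cut: "col_count D y + 1 = p" if "p \<in> set ps" "rw p < y + M" "y \<le> rw p" "1 \<le> y" for p y
    using col_count_trimmed_cut[OF ps(4) that] good(1)[OF that(1)] unfolding D_def by simp
  have memD: "(x, y) \<in> D \<longleftrightarrow> 1 \<le> x \<and> 1 \<le> y \<and> y + (if x \<in> set ps then M else 0) \<le> rw x" for x y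
    unfolding D_def by (rule mem_trimmed)
  have c_le: "b + m + M \<le> rw p" if "p \<in> set ps" for p
  proof -
    have "b + m \<le> rw (r + 1)" using rw_iff_ht[of "r + 1" "b + m"] ht_corner b_pos by simp
    also have "\<dots> \<le> rw (p + 1)" using rw_anti good[OF that] by simp
    finally show ?thesis using good(3)[OF that] by simp
  qed
  have hts: "col_count D y = ht y" if "y \<le> b + m" for y
    unfolding D_def
  proof (rule col_count_trimmed_uncut[OF ps(4)])
    show "y + M \<le> rw p" if "p \<in> set ps" for p using c_le[OF that] \<open>y \<le> b + m\<close> by simp
  qed
  have r_ps: "r \<in> set ps" using ps(1,2) hd_in_set by blast
  interpret S: strips k M b D ps
  proof
    show "1 \<le> p" if "p \<in> set ps" for p using good(1)[OF that] .
    show "row_count D p + M \<le> row_count D (p - 1)" if p: "p \<in> set ps" "1 < p" for p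
    proof (cases "p - 1 \<in> set ps")
      case True
      then show ?thesis using long[OF True, of p] row_ps[OF True] row_ps[OF p(1)] p by simp
    next
      case False
      then show ?thesis using rows[of "p - 1"] row_ps[OF p(1)] rw_anti[of "p - 1" p] p by simp
    qed
    show mem: "(hd ps, b) \<in> D" using memD c_le[OF r_ps] corner_pos b_pos ps(2) r_ps by simp
    show "hook_length D (hd ps, b) = k"
      using hook_length_add[OF diagD mem] ps(2) hts[of b] block_heights[of b] ht_corner row_ps[OF r_ps] rw_corner k_corner by simp
    show "col_count D (b + j) = col_count D b" if "j < M" for j
      using hts[of "b + j"] hts[of b] block_heights[of "b + j"] block_heights[of b] that by simp
  next
    fix i assume i: "Suc i < length ps"
    define p q where "p = ps ! i" and "q = ps ! Suc i"
    have pq: "p \<in> set ps" "q \<in> set ps" using i unfolding p_def q_def by auto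
    have q: "q < p" "k + 1 \<le> hook q (rw p)" "hook q (rw p) \<le> k + 2" "1 \<le> q"
      using ps(5)[OF i] good(1)[OF pq(2)] unfolding p_def q_def next_row_def by auto
    have wide: "rw p + M \<le> rw q" using long[OF pq(2)] q by simp
    have rp: "row_count D p + M = rw p" "row_count D q + M = rw q" using row_ps pq by simp_all
    have pos: "1 \<le> row_count D p" using c_le[OF pq(1)] rp b_pos by simp
    have memE: "(q, rw p) \<in> E" using mem_rw wide q rp pos by simp
    have "\<not> p + 1 \<le> ht (rw p)" using rw_iff_ht[of "p + 1" "rw p"] good[OF pq(1)] rp pos by simp
    moreover have "p \<le> ht (rw p)" using rw_iff_ht[of p "rw p"] good[OF pq(1)] rp pos by simp
    ultimately have hE: "hook q (rw p) + q + rw p = rw q + p + 1" using hook_add[OF memE] by simp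
    have mem1: "(q, row_count D p + 1) \<in> D" using memD pq q rp wide by simp
    have "col_count D (row_count D p + 1) + 1 = p" using cut[OF pq(1), of "row_count D p + 1"] rp by simp
    \<comment> \<open>The first of the trimmed columns is \<open>m\<close> to the left of column \<open>rw p\<close>;
      row \<open>q\<close> has lost \<open>m + 1\<close> cells, that column one.\<close>
    then have h1: "hook_length D (q, row_count D p + 1) + 2 = hook q (rw p)"
      using hook_length_add[OF diagD mem1] rp hE by simp
    then show "k \<le> hook_length D (ps ! Suc i, row_count D (ps ! i) + 1) + 1"
      "hook_length D (ps ! Suc i, row_count D (ps ! i) + 1) \<le> k"
      using q unfolding p_def q_def by simp_all
    have mem0: "(q, row_count D p) \<in> D" using memD pq q rp wide pos by simp
    have "p \<le> col_count D (row_count D p)"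
      using row_le_iff_col_le[OF diagD good(1)[OF pq(1)] pos] by simp
    then show "k < hook_length D (ps ! Suc i, row_count D (ps ! i))"
      using hook_length_add[OF diagD mem0] rp hE q unfolding p_def[symmetric] q_def[symmetric] by simp
    assume "1 < ps ! Suc i"
    then have q1: "1 < q" "1 \<le> q - 1" unfolding q_def by simp_all
    have "rw q \<le> row_count D (q - 1)"
    proof (cases "q - 1 \<in> set ps")
      case True
      then show ?thesis using long[OF True, of q] row_ps[OF True] q1 by simp
    next
      case False
      then show ?thesis using rows[OF q1(2)] rw_anti[OF q1(2), of q] by simp
    qed
    moreover from this have memb: "(q - 1, rw p) \<in> D"
      using mem_diagram_row[OF diagD] q1 wide rp pos by simp
    moreover have "col_count D (rw p) + 1 = p" using cut[OF pq(1), of "rw p"] rp pos by simp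
    ultimately have "k < hook_length D (q - 1, rw p)"
      using hook_length_add[OF diagD memb] hE q q1 by simp
    then show "k < hook_length D (ps ! Suc i - 1, row_count D (ps ! i) + M)"
      using rp unfolding p_def q_def by simp
  next
    fix x n assume n: "n < M" and mem: "(x, row_count D (last ps) + Suc n) \<in> D"
    let ?p = "last ps"
    have p: "?p \<in> set ps" using ps(1) by simp
    let ?y = "row_count D ?p + Suc n"
    have y: "?y = rw ?p - (m - n)" using row_ps[OF p] n by simp
    have h: "col_count D ?y + 1 = ?p" using cut[OF p, of ?y] row_ps[OF p] n by simp
    have x: "1 \<le> x" "x < ?p" using mem mem_diagram_col[OF diagD] h by auto
    have xps: "x \<notin> set ps"
    proof
      assume "x \<in> set ps"
      then obtain i where i: "i < length ps" "x = ps ! i" by (auto simp: in_set_conv_nth)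
      have "last ps \<le> x"
        using ps(3) i ps(1) unfolding sorted_wrt_iff_nth_less last_conv_nth[OF ps(1)]
        by (cases "i = length ps - 1") (auto intro!: less_imp_le)
      then show False using x by simp
    qed
    have memE: "(x, ?y) \<in> E" using mem unfolding D_def trimmed_def by simp
    have "ht ?y = ?p"
    proof -
      have "?p \<le> ht ?y" using rw_iff_ht[OF good(1)[OF p], of ?y] row_ps[OF p] n by simp
      moreover have "\<not> ?p + 1 \<le> ht ?y" using rw_iff_ht[of "?p + 1" ?y] good(3)[OF p] row_ps[OF p] by simp
      ultimately show ?thesis by simp
    qed
    then have "hook x ?y = hook_length D (x, ?y) + 1"
      using hook_add[OF memE] hook_length_add[OF diagD mem] h rows[OF x(1)] xps by simp
    moreover have "hook x ?y \<noteq> k + 1"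
      using ps(6) x(2) memE unfolding final_row_def y by (metis diff_le_self)
    ultimately show "hook_length D (x, ?y) \<noteq> k" by simp
  qed (use diagD ps in blast)+

  have filled: "S.filled M = E"
  proof (intro set_eqI)
    fix z :: cell
    obtain x y where z: "z = (x, y)" by (cases z)
    show "z \<in> S.filled M \<longleftrightarrow> z \<in> E"
    proof (cases "1 \<le> x")
      case True
      then have "row_count D x + (if x \<in> set ps then M else 0) = rw x"
        using rows[OF True] row_ps[of x] by auto
      then show ?thesis unfolding z S.mem_filled mem_rw by simp
    qed (simp add: z S.mem_filled mem_rw)
  qed
  define L where "L = rw (last ps)"
  have last: "last ps \<in> set ps" using ps(1) by simp
  have L: "row_count D (last ps) + M = L" using row_ps[OF last] unfolding L_def .
  have stop: "\<And>j. j \<le> m \<Longrightarrow> col_size (L - j) = col_size L" "col_size (L + 1) < col_size L"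
    using ps(6) unfolding final_row_def L_def by auto
  have LM: "b + m + M \<le> L" using c_le[OF last] unfolding L_def .
  define e where "e = cs k D"
  have cs: "col_size y + of_bool (b \<le> y \<and> y < b + M) = e y + of_bool (L < y + M \<and> y \<le> L)" for y
    using S.cs_filled[of M y] L unfolding filled e_def by auto
  have "e (Suc i) \<le> e i" if "1 \<le> i" for i
  proof -
    have anti: "col_size (Suc i) \<le> col_size i" using col_size_anti[OF that] by simp
    have "col_size (Suc i) < col_size i" if "Suc i = b"
    proof -
      have "b \<noteq> 1" "b - 1 = i" using that \<open>1 \<le> i\<close> by auto
      then show ?thesis using block_start block[of b] that by simp
    qed
    moreover have "col_size (Suc i) < col_size i" if "i = L" using stop(2) that by simp
    ultimately show ?thesis
      using cs[of i] cs[of "Suc i"] anti LM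
      by (cases "i = L"; cases "Suc i = b") (auto simp: of_bool_def split: if_splits)
  qed
  then have "is_partition (cs k D)"
    using finite_support_cs[OF diagD] unfolding is_partition_def e_def by simp
  moreover have "is_partition (rs k D)"
    using shape S.rs_filled[of M] unfolding filled kshapes_def by simp
  ultimately have "D \<in> kshapes k"
    using diagD unfolding kshapes_def by simp
  moreover have "cs k D (b + j) = cs k D b" if "j < M" for j
    using cs[of "b + j"] cs[of b] block[of "b + j"] block[of b] that LM unfolding e_def[symmetric]
    by simp
  moreover have "cs k D (row_count D (last ps) + Suc j) = cs k D (row_count D (last ps) + 1)" if "j < M" for j
  proof -
    have y: "row_count D (last ps) + Suc j = L - (m - j)" "row_count D (last ps) + 1 = L - m"
      using L that by auto
    show ?thesis
      using cs[of "L - (m - j)"] cs[of "L - m"] stop(1)[of "m - j"] stop(1)[of m] that LM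
      unfolding y e_def[symmetric] by (auto simp: of_bool_def split: if_splits)
  qed
  ultimately have "row_move k M (length ps) D E"
    using S.row_move_filled shape unfolding filled by blast
  moreover have "rs k D = rs k E" using S.rs_filled[of M] filled by simp
  ultimately show ?thesis by blast
qed

end

lemma row_move_to:
  assumes E: "E \<in> kshapes k" and k: "2 \<le> k"
    and hook: "(r', c') \<in> E" "hook_length E (r', c') = k + 1"
  shows "\<exists>M\<ge>1. \<exists>l D. row_move k M l D E \<and> rs k D = rs k E"
proof -
  interpret kshape k E using E k by unfold_locales
  define c where "c = (LEAST c. \<exists>x. (x, c) \<in> E \<and> hook x c = k + 1)"
  have "\<exists>x. (x, c) \<in> E \<and> hook x c = k + 1"
    unfolding c_def by (rule LeastI_ex[of "\<lambda>c. \<exists>x. (x, c) \<in> E \<and> hook x c = k + 1"]) (use hook in blast)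
  then obtain r where rc: "(r, c) \<in> E" "hook r c = k + 1" by blast
  have min: "hook x y \<noteq> k + 1" if "(x, y) \<in> E" "y < c" for x y
    using not_less_Least[of y "\<lambda>c. \<exists>x. (x, c) \<in> E \<and> hook x c = k + 1"] that unfolding c_def by blast
  have c1: "1 \<le> c" using rc(1) mem_rw by auto
  define b where "b = (LEAST y. 1 \<le> y \<and> col_size y = col_size c)"
  have b: "1 \<le> b" "col_size b = col_size c"
    unfolding b_def using LeastI[of "\<lambda>y. 1 \<le> y \<and> col_size y = col_size c" c] c1 by simp_all
  have bc: "b \<le> c" unfolding b_def using c1 by (intro Least_le) simp
  have start: "b = 1 \<or> col_size c < col_size (b - 1)"
  proof (cases "b = 1")
    case False
    then have b': "1 \<le> b - 1" "b - 1 < b" using b(1) by auto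
    then have "col_size (b - 1) \<noteq> col_size c"
      using not_less_Least[of "b - 1" "\<lambda>y. 1 \<le> y \<and> col_size y = col_size c"] unfolding b_def by blast
    moreover have "col_size c \<le> col_size (b - 1)" using col_size_anti[OF b'(1), of c] bc by simp
    ultimately show ?thesis by simp
  qed simp
  obtain m where m: "c = b + m" using bc le_Suc_ex by blast
  have block: "col_size y = col_size c" if "b \<le> y" "y \<le> c" for y
    using col_size_anti[of b y] col_size_anti[of y c] that b by simp
  interpret move_target k E r b m
    using rc min b(1) block start unfolding m by unfold_locales
  show ?thesis using row_move_to_corner by (intro exI[of _ "Suc m"]) simp
qed

section \<open>Extremal elements\<close>

lemma card_boundary_eq:
  assumes "is_diagram D" "is_diagram E" "rs k D = rs k E"
  shows "card (boundary k D) = card (boundary k E)"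
proof -
  have sum: "card (boundary k F) = (\<Sum>x\<le>n. rs k F x)" if "is_diagram F" "col_count F 1 \<le> n" for F n
  proof -
    have fin: "finite {j. (x, j) \<in> boundary k F}" for x
    proof (rule finite_subset)
      show "{j. (x, j) \<in> boundary k F} \<subseteq> {..row_count F x}"
        unfolding boundary_def using mem_diagram_row[OF that(1)] by auto
    qed simp
    have "x \<le> n" if "(x, j) \<in> boundary k F" for x j
    proof -
      have "(x, j) \<in> F" using that unfolding boundary_def by simp
      then have "x \<le> col_count F j" "1 \<le> j" using mem_diagram_col[OF \<open>is_diagram F\<close>] by auto
      then show ?thesis using col_count_mono[OF \<open>is_diagram F\<close>, of 1 j] \<open>col_count F 1 \<le> n\<close> by simp
    qed
    then have "boundary k F = (SIGMA x:{..n}. {j. (x, j) \<in> boundary k F})" by auto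
    then have "card (boundary k F) = card (SIGMA x:{..n}. {j. (x, j) \<in> boundary k F})" by simp
    also have "\<dots> = (\<Sum>x\<le>n. rs k F x)" unfolding rs_def row_count_def using fin by (intro card_SigmaI) auto
    finally show ?thesis .
  qed
  show ?thesis
    using sum[OF assms(1), of "max (col_count D 1) (col_count E 1)"]
      sum[OF assms(2), of "max (col_count D 1) (col_count E 1)"] assms(3) by simp
qed

lemma edgeI:
  assumes "row_move k M l D E" "1 \<le> M" "rs k D = rs k E"
    and "D \<in> kshapes_of_size k N \<or> E \<in> kshapes_of_size k N"
  shows "kshape_edge k N D E"
proof -
  have "D \<in> kshapes k" "E \<in> kshapes k" using assms(1) unfolding row_move_def by auto
  moreover from this have "card (boundary k D) = card (boundary k E)"
    using card_boundary_eq[OF _ _ assms(3)] kshapesD(1) by blast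
  moreover have "nonempty_move k D E" using assms(1,2) unfolding nonempty_move_def by blast
  ultimately show ?thesis using assms(4) unfolding kshape_edge_def kshapes_of_size_def by auto
qed

lemma edge_converse:
  assumes "kshape_edge k N D E"
  shows "kshape_edge k N (D\<inverse>) (E\<inverse>)"
proof -
  have "nonempty_move k (D\<inverse>) (E\<inverse>)"
    using assms unfolding kshape_edge_def nonempty_move_def column_move_def by auto
  then show ?thesis using assms unfolding kshape_edge_def by simp
qed

lemma edge_to_if_not_core:
  assumes "2 \<le> k" and E: "E \<in> kshapes_of_size k N" and "\<not> is_core (k + 1) E"
  shows "\<exists>D. kshape_edge k N D E"
proof -
  have shape: "E \<in> kshapes k" using E unfolding kshapes_of_size_def by simp
  then obtain x y where "(x, y) \<in> E" "hook_length E (x, y) = k + 1"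
    using assms(3) kshapesD(1) unfolding is_core_def by auto
  from row_move_to[OF shape assms(1) this] show ?thesis using edgeI E by blast
qed

lemma edge_from_if_not_core:
  assumes "2 \<le> k" and D: "D \<in> kshapes_of_size k N" and "\<not> is_core k D"
  shows "\<exists>E. kshape_edge k N D E"
proof -
  have shape: "D \<in> kshapes k" using D unfolding kshapes_of_size_def by simp
  note diag = kshapesD(1)[OF shape]
  from diag obtain x y where xy: "(x, y) \<in> D" "hook_length D (x, y) = k"
    using assms(3) unfolding is_core_def by auto
  show ?thesis
  proof (cases "2 \<le> cs k D y")
    case True
    from row_move_from[OF shape assms(1) xy True] show ?thesis using edgeI D by metis
  next
    case False
    \<comment> \<open>Row and column sizes at a cell with hook length \<open>k\<close> add up to \<open>k + 1\<close>, so the row has size \<open>k\<close>.\<close>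
    have "k + 1 = rs k D x + cs k D y"
      using hook_eq_cs[OF diag xy] hook_eq_rs[OF diag xy] hook_length_add[OF diag xy(1)] xy(2) by simp
    then have "2 \<le> cs k (D\<inverse>) x" using False assms(1) by (simp add: cs_converse)
    moreover have "(y, x) \<in> D\<inverse>" "hook_length (D\<inverse>) (y, x) = k" "D\<inverse> \<in> kshapes k"
      using xy shape by (simp_all add: hook_length_converse)
    ultimately obtain E M l where "1 \<le> M" "row_move k M l (D\<inverse>) E" "rs k (D\<inverse>) = rs k E"
      using row_move_from[OF _ assms(1)] by metis
    then have "kshape_edge k N (D\<inverse>) E" using edgeI D by simp
    then have "kshape_edge k N D (E\<inverse>)" using edge_converse by fastforce
    then show ?thesis by blast
  qed
qed

theorem proposition28:
  fixes k N :: nat and D :: diagram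
  assumes "k \<ge> 2" and "D \<in> kshapes_of_size k N"
  shows "(kshape_maximal k N D \<longleftrightarrow> is_core (k + 1) D) \<and>
         (kshape_minimal k N D \<longleftrightarrow> is_core k D)"
proof -
  have shapes: "X \<in> kshapes_of_size k N" "Y \<in> kshapes_of_size k N" "nonempty_move k X Y"
    if "kshape_edge k N X Y" for X Y
    using that unfolding kshape_edge_def by auto
  have "kshape_maximal k N D \<longleftrightarrow> (\<nexists>X. kshape_edge k N X D)"
    unfolding kshape_maximal_def kshape_less_def using assms(2) shapes
    by (metis (no_types, lifting) tranclp.r_into_trancl tranclpD)
  moreover have "kshape_minimal k N D \<longleftrightarrow> (\<nexists>X. kshape_edge k N D X)"
    unfolding kshape_minimal_def kshape_less_def using assms(2) shapes
    by (metis (no_types, lifting) tranclp.r_into_trancl tranclp.cases)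
  moreover have "\<not> is_core (k + 1) D" if "kshape_edge k N X D" for X
    using nonempty_move_hooks(2)[OF shapes(3)[OF that]] unfolding is_core_def by blast
  moreover have "\<not> is_core k D" if "kshape_edge k N D X" for X
    using nonempty_move_hooks(1)[OF shapes(3)[OF that]] unfolding is_core_def by blast
  ultimately show ?thesis
    using edge_to_if_not_core[OF assms] edge_from_if_not_core[OF assms] by blast
qed

end
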